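(* Let $V$ be a vector space over a field $F$ of dimension $d$, and let $H\subseteq V$ be a hyperplane. Then the Coxeter pairs $[\mathcal P]\otimes[\mathcal Q]$, $\mathcal P=(P_1,\dots,P_d)$, $\mathcal Q=(Q_1,\dots,Q_d)$, with $P_1,\dots,P_{d-1}\subseteq H$ generate $\mathrm{St}(V)\otimes_{\mathbb Q}\mathrm{St}(V)$ as a $\mathbb Q$-vector space.
   Context: **Steinberg module.** For a $d$-dimensional vector space $V$ over $F$, $\mathrm{St}(V)=\widetilde H_{d-2}(\mathcal T_V,\mathbb Q)$ ($\mathcal T_V$ the Tits building), with $\mathrm{St}(V)=\mathbb Q$ if $d\le 1$. Equivalently it is the $\mathbb Q$-vector space generated by apartments $[v_1,\dots,v_d]$, $v_i\in V\setminus\{0\}$, which vanish for linearly dependent $v_i$, are skew-symmetric, are unchanged when a $v_i$ is multiplied by an element of $F^\times$, and satisfy $\sum_{i=0}^d(-1)^i[v_0,\dots,\widehat{v_i},\dots,v_d]=0$ for nonzero $v_0,\dots,v_d\in V$. For lines $P_i=\langle v_i\rangle$ in $V$ (points of $\mathbb P(V)$) write $[P_1,\dots,P_d]=[v_1,\dots,v_d]$. **Coxeter pairs.** A projective simplex is an ordered $d$-tuple $\mathcal P=(P_1,\dots,P_d)$ of lines in $V$; it is non-degenerate if $P_1,\dots,P_d$ span $V$; put $[\mathcal P]=[P_1,\dots,P_d]\in\mathrm{St}(V)$. A pair $(\mathcal P,\mathcal Q)$ of simplexes is a Coxeter pair if both are non-degenerate, $P_1=Q_1$, and $Q_i\subseteq\langle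 P_{i-1},P_i\rangle$ for $i=2,\dots,d$; the element $[\mathcal P]\otimes[\mathcal Q]$ is also called a Coxeter pair. *)

theory Defs
  imports "HOL-Algebra.Algebraic_Closure_Type"
begin

section \<open>Rational vector spaces: free, quotient and tensor product\<close>

text \<open>
  Rational vector spaces are modules over \<open>rat_ring\<close>. The multiplication and unit that a module
  record inherits from the ring record play no role and are left \<open>undefined\<close>.
\<close>

abbreviation rat_ring :: "rat ring"
  where "rat_ring \<equiv> ring_of_type_algebra"

definition submodule_span :: "('r, 'm) ring_scheme \<Rightarrow> ('r, 'a, 'n) module_scheme \<Rightarrow> 'a set \<Rightarrow> 'a set"
  where "submodule_span R M S = (\<lambda>N. submodule N R M) hull S"

definition free_rat :: "'a set \<Rightarrow> (rat, 'a \<Rightarrow> rat) module"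
  where "free_rat A =
    \<lparr>carrier = {f. finite {x. f x \<noteq> 0} \<and> {x. f x \<noteq> 0} \<subseteq> A},
     monoid.mult = undefined, one = undefined,
     ring.zero = (\<lambda>_. 0),
     add = (\<lambda>f g x. f x + g x),
     module.smult = (\<lambda>c f x. c * f x)\<rparr>"

definition free_gen :: "'a \<Rightarrow> 'a \<Rightarrow> rat"
  where "free_gen x = (\<lambda>y. if y = x then 1 else 0)"

definition quotient_module :: "('r, 'a, 'n) module_scheme \<Rightarrow> 'a set \<Rightarrow> ('r, 'a set) module"
  where "quotient_module M N =
    \<lparr>carrier = a_rcosets\<^bsub>M\<^esub> N,
     monoid.mult = undefined, one = undefined,
     ring.zero = N,
     add = set_add M,
     module.smult = (\<lambda>c A. \<Union>a\<in>A. N +>\<^bsub>M\<^esub> (c \<odot>\<^bsub>M\<^esub> a))\<rparr>"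

definition bilinear_relations ::
    "(rat, 'a, 'm) module_scheme \<Rightarrow> (rat, 'b, 'n) module_scheme \<Rightarrow> ('a \<times> 'b \<Rightarrow> rat) set"
  where "bilinear_relations M N =
      {\<lambda>p. free_gen (x \<oplus>\<^bsub>M\<^esub> x', y) p - free_gen (x, y) p - free_gen (x', y) p | x x' y.
         x \<in> carrier M \<and> x' \<in> carrier M \<and> y \<in> carrier N}
    \<union> {\<lambda>p. free_gen (x, y \<oplus>\<^bsub>N\<^esub> y') p - free_gen (x, y) p - free_gen (x, y') p | x y y'.
         x \<in> carrier M \<and> y \<in> carrier N \<and> y' \<in> carrier N}
    \<union> {\<lambda>p. free_gen (c \<odot>\<^bsub>M\<^esub> x, y) p - c * free_gen (x, y) p | c x y.
         x \<in> carrier M \<and> y \<in> carrier N}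
    \<union> {\<lambda>p. free_gen (x, c \<odot>\<^bsub>N\<^esub> y) p - c * free_gen (x, y) p | c x y.
         x \<in> carrier M \<and> y \<in> carrier N}"

definition bilinear_kernel ::
    "(rat, 'a, 'm) module_scheme \<Rightarrow> (rat, 'b, 'n) module_scheme \<Rightarrow> ('a \<times> 'b \<Rightarrow> rat) set"
  where "bilinear_kernel M N =
    submodule_span rat_ring (free_rat (carrier M \<times> carrier N)) (bilinear_relations M N)"

definition tensor_product ::
    "(rat, 'a, 'm) module_scheme \<Rightarrow> (rat, 'b, 'n) module_scheme \<Rightarrow> (rat, ('a \<times> 'b \<Rightarrow> rat) set) module"
  where "tensor_product M N =
    quotient_module (free_rat (carrier M \<times> carrier N)) (bilinear_kernel M N)"

definition pure_tensor ::
    "(rat, 'a, 'm) module_scheme \<Rightarrow> (rat, 'b, 'n) module_scheme \<Rightarrow> 'a \<Rightarrow> 'b \<Rightarrow> ('a \<times> 'b \<Rightarrow> rat) set"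
  where "pure_tensor M N x y =
    bilinear_kernel M N +>\<^bsub>free_rat (carrier M \<times> carrier N)\<^esub> free_gen (x, y)"


section \<open>The Steinberg module\<close>

text \<open>
  Below, \<open>V\<close> is a finite-dimensional subspace of the ambient type (possibly all of it),
  and a \<open>d\<close>-tuple is a list of length \<open>d\<close>, so its entries are indexed from \<open>0\<close>.
\<close>

definition nonzero_tuples :: "'v::ab_group_add set \<Rightarrow> nat \<Rightarrow> 'v list set"
  where "nonzero_tuples V n = {vs. length vs = n \<and> set vs \<subseteq> V - {0}}"

definition free_apartments ::
    "('f::field \<Rightarrow> 'v::ab_group_add \<Rightarrow> 'v) \<Rightarrow> 'v set \<Rightarrow> (rat, 'v list \<Rightarrow> rat) module"
  where "free_apartments scale V = free_rat (nonzero_tuples V (vector_space.dim scale V))"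

text \<open>
  Linear dependence is that of the family, so a tuple with a repeated entry is dependent.
  In the last relation \<open>take i vs @ drop (Suc i) vs\<close> is \<open>vs\<close> with the entry at \<open>i\<close> omitted.
\<close>

definition steinberg_relations ::
    "('f::field \<Rightarrow> 'v::ab_group_add \<Rightarrow> 'v) \<Rightarrow> 'v set \<Rightarrow> ('v list \<Rightarrow> rat) set"
  where "steinberg_relations scale V = (let d = vector_space.dim scale V in
      {free_gen vs | vs.
         vs \<in> nonzero_tuples V d \<and> (\<not> distinct vs \<or> module.dependent scale (set vs))}
    \<union> {\<lambda>us. free_gen (vs[i := vs ! j, j := vs ! i]) us + free_gen vs us | vs i j.
         vs \<in> nonzero_tuples V d \<and> i < d \<and> j < d \<and> i \<noteq> j}
    \<union> {\<lambda>us. free_gen (vs[i := scale c (vs ! i)]) us - free_gen vs us | vs i c.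
         vs \<in> nonzero_tuples V d \<and> i < d \<and> c \<noteq> 0}
    \<union> {\<lambda>us. \<Sum>i\<le>d. (- 1) ^ i * free_gen (take i vs @ drop (Suc i) vs) us | vs.
         vs \<in> nonzero_tuples V (Suc d)})"

definition steinberg_kernel ::
    "('f::field \<Rightarrow> 'v::ab_group_add \<Rightarrow> 'v) \<Rightarrow> 'v set \<Rightarrow> ('v list \<Rightarrow> rat) set"
  where "steinberg_kernel scale V =
    submodule_span rat_ring (free_apartments scale V) (steinberg_relations scale V)"

text \<open>
  This is the apartment presentation of the top reduced rational homology of the Tits building
  of \<open>V\<close>. The space it gives is one-dimensional when \<open>V\<close> has dimension at most \<open>1\<close>.
\<close>

definition steinberg ::
    "('f::field \<Rightarrow> 'v::ab_group_add \<Rightarrow> 'v) \<Rightarrow> 'v set \<Rightarrow> (rat, ('v list \<Rightarrow> rat) set) module"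
  where "steinberg scale V = quotient_module (free_apartments scale V) (steinberg_kernel scale V)"

definition apartment ::
    "('f::field \<Rightarrow> 'v::ab_group_add \<Rightarrow> 'v) \<Rightarrow> 'v set \<Rightarrow> 'v list \<Rightarrow> ('v list \<Rightarrow> rat) set"
  where "apartment scale V vs = steinberg_kernel scale V +>\<^bsub>free_apartments scale V\<^esub> free_gen vs"


section \<open>Projective simplexes and Coxeter pairs\<close>

definition projective_points ::
    "('f::field \<Rightarrow> 'v::ab_group_add \<Rightarrow> 'v) \<Rightarrow> 'v set \<Rightarrow> 'v set set"
  where "projective_points scale V = {module.span scale {v} | v. v \<in> V - {0}}"

definition projective_simplex ::
    "('f::field \<Rightarrow> 'v::ab_group_add \<Rightarrow> 'v) \<Rightarrow> 'v set \<Rightarrow> 'v set list \<Rightarrow> bool"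
  where "projective_simplex scale V Ps \<longleftrightarrow>
    length Ps = vector_space.dim scale V \<and> set Ps \<subseteq> projective_points scale V"

definition nondegenerate ::
    "('f::field \<Rightarrow> 'v::ab_group_add \<Rightarrow> 'v) \<Rightarrow> 'v set \<Rightarrow> 'v set list \<Rightarrow> bool"
  where "nondegenerate scale V Ps \<longleftrightarrow> module.span scale (\<Union>(set Ps)) = V"

text \<open>
  The choice of a generator of each line does not affect the class, by the scaling relations.
\<close>

definition simplex_class ::
    "('f::field \<Rightarrow> 'v::ab_group_add \<Rightarrow> 'v) \<Rightarrow> 'v set \<Rightarrow> 'v set list \<Rightarrow> ('v list \<Rightarrow> rat) set"
  where "simplex_class scale V Ps =
    apartment scale V (map (\<lambda>P. SOME v. P = module.span scale {v}) Ps)"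

definition coxeter_pair ::
    "('f::field \<Rightarrow> 'v::ab_group_add \<Rightarrow> 'v) \<Rightarrow> 'v set \<Rightarrow> 'v set list \<Rightarrow> 'v set list \<Rightarrow> bool"
  where "coxeter_pair scale V Ps Qs \<longleftrightarrow>
    projective_simplex scale V Ps \<and> projective_simplex scale V Qs \<and>
    nondegenerate scale V Ps \<and> nondegenerate scale V Qs \<and>
    Ps ! 0 = Qs ! 0 \<and>
    (\<forall>i. 1 \<le> i \<and> i < vector_space.dim scale V \<longrightarrow>
      Qs ! i \<subseteq> module.span scale (Ps ! (i - 1) \<union> Ps ! i))"

definition coxeter_tensor ::
    "('f::field \<Rightarrow> 'v::ab_group_add \<Rightarrow> 'v) \<Rightarrow> 'v set \<Rightarrow> 'v set list \<Rightarrow> 'v set list \<Rightarrow>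
     (('v list \<Rightarrow> rat) set \<times> ('v list \<Rightarrow> rat) set \<Rightarrow> rat) set"
  where "coxeter_tensor scale V Ps Qs =
    pure_tensor (steinberg scale V) (steinberg scale V)
      (simplex_class scale V Ps) (simplex_class scale V Qs)"

definition hyperplane ::
    "('f::field \<Rightarrow> 'v::ab_group_add \<Rightarrow> 'v) \<Rightarrow> 'v set \<Rightarrow> 'v set \<Rightarrow> bool"
  where "hyperplane scale V H \<longleftrightarrow>
    module.subspace scale H \<and> H \<subseteq> V \<and>
    vector_space.dim scale V = Suc (vector_space.dim scale H)"

end

theory Submission
  imports Defs "HOL-Library.Function_Algebras"
begin

text \<open>
  By duality it suffices that a bilinear form on \<open>St(V) \<times> St(V)\<close> vanishing on the given Coxeter
  pairs is zero. Two consequences of the apartment relations are used: \<open>St(V)\<close> is generated by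
  the \<open>[h, l]\<close> with \<open>h\<close> a tuple in a fixed hyperplane \<open>H\<close> and \<open>l \<notin> H\<close>, and also by the
  \<open>[k, m]\<close> with last entry a fixed \<open>m\<close>. Let \<open>K\<close> be a hyperplane and \<open>m, l \<notin> K\<close>. Appending \<open>m\<close>
  and \<open>l\<close> turns a Coxeter pair of \<open>K\<close> into one of \<open>V\<close> as soon as \<open>m\<close> and \<open>l\<close> are parallel, or
  the last entry of its first simplex spans \<open>\<langle>m, l\<rangle> \<inter> K\<close>. So one proves by induction on the
  dimension that, for any prescribed point \<open>n\<close>, the Coxeter pairs whose first simplex ends in \<open>n\<close>
  generate: expand the first factor by the \<open>[k, n]\<close>, and the second one by the \<open>[h, l]\<close>
  with respect to \<open>K = \<langle>k\<rangle>\<close>. The theorem follows by expanding both factors with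
  respect to \<open>H\<close> and using the statement just proved inside \<open>H\<close>.
\<close>


section \<open>Quotients, tensor products and linear functionals\<close>

lemma submodule_subset_carrier: "submodule N R M \<Longrightarrow> N \<subseteq> carrier M"
  using subgroup.subset[of N "add_monoid M"] by (simp add: submodule_def)

lemma submodule_zero: "submodule N R M \<Longrightarrow> \<zero>\<^bsub>M\<^esub> \<in> N"
  using subgroup.one_closed[of N "add_monoid M"] by (simp add: submodule_def)

lemma submodule_add: "submodule N R M \<Longrightarrow> x \<in> N \<Longrightarrow> y \<in> N \<Longrightarrow> x \<oplus>\<^bsub>M\<^esub> y \<in> N"
  using subgroup.m_closed[of N "add_monoid M"] by (simp add: submodule_def)

lemma submodule_neg: "submodule N R M \<Longrightarrow> x \<in> N \<Longrightarrow> \<ominus>\<^bsub>M\<^esub> x \<in> N"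
  using subgroup.m_inv_closed[of N "add_monoid M"] by (simp add: submodule_def a_inv_def)

lemma submodule_abelian_subgroup:
  assumes "Module.module R M" "submodule N R M"
  shows "abelian_subgroup N M"
proof (rule abelian_subgroupI3)
  show "additive_subgroup N M"
    using assms(2) by (simp add: submodule_def additive_subgroup_def)
  show "abelian_group M"
    using assms(1) by (simp add: Module.module_def)
qed

text \<open>The hull is the intersection of all submodules containing \<open>S\<close>. Since
  \<open>S\<close> lies in the carrier, the carrier is one of them, which keeps the intersection
  inside \<open>M\<close>.\<close>

lemma submodule_span_submodule:
  assumes M: "Module.module R M" and S: "S \<subseteq> carrier M"
  shows "submodule (submodule_span R M S) R M"
proof -
  interpret M: Module.module R M by (rule M)
  have mem: "x \<in> submodule_span R M S \<longleftrightarrow> (\<forall>N. submodule N R M \<longrightarrow> S \<subseteq> N \<longrightarrow> x \<in> N)" for x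
    by (auto simp: submodule_span_def hull_def)
  show ?thesis
  proof (rule M.submoduleI)
    show "submodule_span R M S \<subseteq> carrier M"
      using S M.carrier_is_submodule mem by blast
  qed (auto simp: mem submodule_zero submodule_neg submodule_add intro: submodule.smult_closed)
qed

context
  fixes R :: "('r, 'k) ring_scheme" and M :: "('r, 'a, 'm) module_scheme" (structure) and N
  assumes M: "Module.module R M" and N: "submodule N R M"
begin

interpretation M: Module.module R M by (rule M)
interpretation N: abelian_subgroup N M by (rule submodule_abelian_subgroup[OF M N])

lemma quotient_module_carrier: "carrier (quotient_module M N) = (\<lambda>x. N +>\<^bsub>M\<^esub> x) ` carrier M"
  by (auto simp: quotient_module_def A_RCOSETS_def' image_def)

lemma quotient_module_zero: "\<zero>\<^bsub>quotient_module M N\<^esub> = N"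
  by (simp add: quotient_module_def)

lemma quotient_module_add:
  "x \<in> carrier M \<Longrightarrow> y \<in> carrier M \<Longrightarrow>
    (N +>\<^bsub>M\<^esub> x) \<oplus>\<^bsub>quotient_module M N\<^esub> (N +>\<^bsub>M\<^esub> y) = N +>\<^bsub>M\<^esub> (x \<oplus>\<^bsub>M\<^esub> y)"
  by (simp add: quotient_module_def N.a_rcos_sum)

text \<open>The scalar multiple of a coset is a union over its representatives. All of them give the
  same coset, because two representatives differ by an element of \<open>N\<close> and
  \<open>N\<close> is closed under scalars.\<close>

lemma quotient_module_smult:
  assumes c: "c \<in> carrier R" and x: "x \<in> carrier M"
  shows "c \<odot>\<^bsub>quotient_module M N\<^esub> (N +>\<^bsub>M\<^esub> x) = N +>\<^bsub>M\<^esub> (c \<odot>\<^bsub>M\<^esub> x)"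
proof -
  have "N +>\<^bsub>M\<^esub> (c \<odot>\<^bsub>M\<^esub> y) = N +>\<^bsub>M\<^esub> (c \<odot>\<^bsub>M\<^esub> x)" if y: "y \<in> N +>\<^bsub>M\<^esub> x" for y
  proof -
    obtain n where n: "n \<in> N" "y = n \<oplus>\<^bsub>M\<^esub> x" using y by (auto simp: a_r_coset_def')
    then have nM: "n \<in> carrier M" using submodule_subset_carrier[OF N] by blast
    have "c \<odot>\<^bsub>M\<^esub> y = c \<odot>\<^bsub>M\<^esub> n \<oplus>\<^bsub>M\<^esub> c \<odot>\<^bsub>M\<^esub> x" using n nM c x by (simp add: M.smult_r_distr)
    moreover have "c \<odot>\<^bsub>M\<^esub> n \<in> N" using submodule.smult_closed[OF N c n(1)] .
    ultimately have "c \<odot>\<^bsub>M\<^esub> y \<in> N +>\<^bsub>M\<^esub> (c \<odot>\<^bsub>M\<^esub> x)" by (auto simp: a_r_coset_def')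
    from M.a_repr_independence[OF this _ N.a_subgroup] show ?thesis using c x by simp
  qed
  then have "(\<Union>y\<in>N +>\<^bsub>M\<^esub> x. N +>\<^bsub>M\<^esub> (c \<odot>\<^bsub>M\<^esub> y)) = (\<Union>y\<in>N +>\<^bsub>M\<^esub> x. N +>\<^bsub>M\<^esub> (c \<odot>\<^bsub>M\<^esub> x))"
    by (rule SUP_cong[OF refl])
  also have "\<dots> = N +>\<^bsub>M\<^esub> (c \<odot>\<^bsub>M\<^esub> x)" using N.a_rcos_self[OF x] by blast
  finally show ?thesis by (simp add: quotient_module_def)
qed

lemma quotient_module_coset_eq_zero: "x \<in> N \<Longrightarrow> N +>\<^bsub>M\<^esub> x = N"
  using M.a_coset_join2[OF _ N.a_subgroup] submodule_subset_carrier[OF N] by blast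

lemma quotient_module_module: "Module.module R (quotient_module M N)"
proof (rule moduleI)
  note rules = quotient_module_carrier quotient_module_add quotient_module_smult
  have zero: "\<zero>\<^bsub>quotient_module M N\<^esub> = N +>\<^bsub>M\<^esub> \<zero>\<^bsub>M\<^esub>"
    using quotient_module_zero quotient_module_coset_eq_zero submodule_zero[OF N] by simp
  show "cring R" by (rule M.R.is_cring)
  show "abelian_group (quotient_module M N)"
  proof (rule abelian_groupI)
    fix C assume "C \<in> carrier (quotient_module M N)"
    then obtain x where x: "x \<in> carrier M" "C = N +>\<^bsub>M\<^esub> x" by (auto simp: rules)
    show "\<exists>Y\<in>carrier (quotient_module M N). Y \<oplus>\<^bsub>quotient_module M N\<^esub> C = \<zero>\<^bsub>quotient_module M N\<^esub>"
      by (rule bexI[of _ "N +>\<^bsub>M\<^esub> (\<ominus>\<^bsub>M\<^esub> x)"]) (auto simp: x zero rules M.l_neg)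
  qed (auto simp: rules zero M.a_assoc, (metis M.a_comm)+)
qed (auto simp: quotient_module_carrier quotient_module_add quotient_module_smult
      M.smult_l_distr M.smult_r_distr M.smult_assoc1)

end

section \<open>Free rational vector spaces\<close>

lemma rat_ring_simps [simp]:
  "carrier rat_ring = UNIV" "a \<oplus>\<^bsub>rat_ring\<^esub> b = a + b" "a \<otimes>\<^bsub>rat_ring\<^esub> b = a * b"
  "\<one>\<^bsub>rat_ring\<^esub> = 1" "\<zero>\<^bsub>rat_ring\<^esub> = 0"
  by (simp_all add: ring_of_type_algebra_def)

lemma free_rat_simps [simp]:
  "f \<oplus>\<^bsub>free_rat A\<^esub> g = (\<lambda>x. f x + g x)" "\<zero>\<^bsub>free_rat A\<^esub> = (\<lambda>_. 0)"
  "c \<odot>\<^bsub>free_rat A\<^esub> f = (\<lambda>x. c * f x)"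
  by (simp_all add: free_rat_def)

lemma free_rat_carrier:
  "f \<in> carrier (free_rat A) \<longleftrightarrow> finite {x. f x \<noteq> 0} \<and> {x. f x \<noteq> 0} \<subseteq> A"
  by (simp add: free_rat_def)

lemma free_rat_add_closed:
  assumes "f \<in> carrier (free_rat A)" "g \<in> carrier (free_rat A)"
  shows "(\<lambda>x. f x + g x) \<in> carrier (free_rat A)"
proof -
  have "{x. f x + g x \<noteq> 0} \<subseteq> {x. f x \<noteq> 0} \<union> {x. g x \<noteq> 0}" by auto
  then show ?thesis using assms by (auto simp: free_rat_carrier intro: finite_subset)
qed

lemma free_rat_smult_closed:
  "f \<in> carrier (free_rat A) \<Longrightarrow> (\<lambda>x. c * f x) \<in> carrier (free_rat A)"
  by (auto simp: free_rat_carrier elim: rev_finite_subset)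

lemma free_rat_diff_closed:
  "f \<in> carrier (free_rat A) \<Longrightarrow> g \<in> carrier (free_rat A) \<Longrightarrow> (\<lambda>x. f x - g x) \<in> carrier (free_rat A)"
  using free_rat_add_closed[of f A "\<lambda>x. - 1 * g x"] free_rat_smult_closed[of g A "- 1"] by simp

lemma free_rat_sum_closed:
  "finite I \<Longrightarrow> (\<And>i. i \<in> I \<Longrightarrow> f i \<in> carrier (free_rat A))
    \<Longrightarrow> (\<lambda>x. \<Sum>i\<in>I. c i * f i x) \<in> carrier (free_rat A)"
proof (induction I rule: finite_induct)
  case (insert i I)
  then show ?case
    using free_rat_add_closed[OF free_rat_smult_closed[of "f i" A "c i"]] by simp
qed (simp add: free_rat_carrier)

lemma free_gen_closed: "x \<in> A \<Longrightarrow> free_gen x \<in> carrier (free_rat A)"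
  by (auto simp: free_rat_carrier free_gen_def)

lemma free_rat_module: "Module.module rat_ring (free_rat A)"
proof (rule moduleI)
  show "abelian_group (free_rat A)"
  proof (rule abelian_groupI)
    fix f assume f: "f \<in> carrier (free_rat A)"
    show "\<exists>g\<in>carrier (free_rat A). g \<oplus>\<^bsub>free_rat A\<^esub> f = \<zero>\<^bsub>free_rat A\<^esub>"
      using free_rat_smult_closed[OF f, of "- 1"] by (intro bexI) auto
  next
    show "\<zero>\<^bsub>free_rat A\<^esub> \<in> carrier (free_rat A)" by (simp add: free_rat_carrier)
  qed (auto simp: free_rat_add_closed)
qed (auto simp: free_rat_smult_closed algebra_simps)

text \<open>Induction over a finite set containing the support: one point \<open>x\<close> of it is
  split off with coefficient \<open>f x\<close>, and \<open>f\<close> with its value at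
  \<open>x\<close> reset to 0 has its support in the smaller set.\<close>

lemma free_rat_induct [consumes 1, case_names zero add]:
  assumes f: "f \<in> carrier (free_rat A)" and zero: "P (\<lambda>_. 0)"
    and add: "\<And>f c x. x \<in> A \<Longrightarrow> f \<in> carrier (free_rat A) \<Longrightarrow> P f \<Longrightarrow> P (\<lambda>y. c * free_gen x y + f y)"
  shows "P f"
proof -
  have "finite S \<Longrightarrow> {x. f x \<noteq> 0} \<subseteq> S \<Longrightarrow> S \<subseteq> A \<Longrightarrow> P f" for S f
  proof (induction S arbitrary: f rule: finite_induct)
    case empty
    then have "f = (\<lambda>_. 0)" by auto
    then show ?case using zero by simp
  next
    case (insert x S)
    let ?g = "\<lambda>y. if y = x then 0 else f y"
    have g: "{y. ?g y \<noteq> 0} \<subseteq> S" using insert.prems(1) by auto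
    then have "?g \<in> carrier (free_rat A)"
      using insert by (auto simp: free_rat_carrier intro: finite_subset)
    then have "P (\<lambda>y. f x * free_gen x y + ?g y)"
      using insert.prems insert.IH[OF g] by (intro add) auto
    moreover have "(\<lambda>y. f x * free_gen x y + ?g y) = f" by (auto simp: free_gen_def)
    ultimately show ?case by simp
  qed
  then show ?thesis using f by (auto simp: free_rat_carrier)
qed

section \<open>Linear functionals and bilinear forms\<close>

definition rat_linear :: "(rat, 'a, 'm) module_scheme \<Rightarrow> ('a \<Rightarrow> rat) \<Rightarrow> bool"
  where "rat_linear M \<gamma> \<longleftrightarrow>
    (\<forall>x\<in>carrier M. \<forall>y\<in>carrier M. \<gamma> (x \<oplus>\<^bsub>M\<^esub> y) = \<gamma> x + \<gamma> y) \<and>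
    (\<forall>c. \<forall>x\<in>carrier M. \<gamma> (c \<odot>\<^bsub>M\<^esub> x) = c * \<gamma> x)"

definition rat_bilinear ::
    "(rat, 'a, 'm) module_scheme \<Rightarrow> (rat, 'b, 'n) module_scheme \<Rightarrow> ('a \<Rightarrow> 'b \<Rightarrow> rat) \<Rightarrow> bool"
  where "rat_bilinear M N \<beta> \<longleftrightarrow>
    (\<forall>y\<in>carrier N. rat_linear M (\<lambda>x. \<beta> x y)) \<and> (\<forall>x\<in>carrier M. rat_linear N (\<beta> x))"

lemma rat_linear_quotient:
  assumes M: "Module.module rat_ring M" and N: "submodule N rat_ring M"
    and \<gamma>: "rat_linear (quotient_module M N) \<gamma>"
  shows "rat_linear M (\<lambda>x. \<gamma> (N +>\<^bsub>M\<^esub> x))" "x \<in> N \<Longrightarrow> \<gamma> (N +>\<^bsub>M\<^esub> x) = 0"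
proof -
  note rules = quotient_module_carrier[OF M N] quotient_module_add[OF M N, symmetric]
    quotient_module_smult[OF M N, symmetric]
  show lin: "rat_linear M (\<lambda>x. \<gamma> (N +>\<^bsub>M\<^esub> x))"
    using \<gamma> by (simp add: rat_linear_def rules)
  interpret M: Module.module rat_ring M by (rule M)
  have "\<gamma> (N +>\<^bsub>M\<^esub> \<zero>\<^bsub>M\<^esub>) = 0"
    using lin M.zero_closed M.smult_r_null[of 0] unfolding rat_linear_def
    by (metis mult_zero_left rat_ring_simps(1) UNIV_I)
  then show "\<gamma> (N +>\<^bsub>M\<^esub> x) = 0" if "x \<in> N"
    using quotient_module_coset_eq_zero[OF M N] submodule_zero[OF N] that by simp
qed

lemma rat_linear_free_add:
  "rat_linear (free_rat A) \<delta> \<Longrightarrow> f \<in> carrier (free_rat A) \<Longrightarrow> g \<in> carrier (free_rat A)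
    \<Longrightarrow> \<delta> (\<lambda>x. f x + g x) = \<delta> f + \<delta> g"
  by (simp add: rat_linear_def)

lemma rat_linear_free_smult:
  "rat_linear (free_rat A) \<delta> \<Longrightarrow> f \<in> carrier (free_rat A) \<Longrightarrow> \<delta> (\<lambda>x. c * f x) = c * \<delta> f"
  by (simp add: rat_linear_def)

lemma rat_linear_free_diff:
  "rat_linear (free_rat A) \<delta> \<Longrightarrow> f \<in> carrier (free_rat A) \<Longrightarrow> g \<in> carrier (free_rat A)
    \<Longrightarrow> \<delta> (\<lambda>x. f x - g x) = \<delta> f - \<delta> g"
  using rat_linear_free_add[of A \<delta> f "\<lambda>x. - 1 * g x"] rat_linear_free_smult[of A \<delta> g "- 1"]
    free_rat_smult_closed[of g A "- 1"] by simp

lemma rat_linear_free_zero: "rat_linear (free_rat A) \<delta> \<Longrightarrow> \<delta> (\<lambda>_. 0) = 0"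
  using rat_linear_free_smult[of A \<delta> "\<lambda>_. 0" 0] by (simp add: free_rat_carrier)

lemma rat_linear_free_sum:
  "rat_linear (free_rat A) \<delta> \<Longrightarrow> finite I \<Longrightarrow> (\<And>i. i \<in> I \<Longrightarrow> f i \<in> carrier (free_rat A))
    \<Longrightarrow> \<delta> (\<lambda>x. \<Sum>i\<in>I. c i * f i x) = (\<Sum>i\<in>I. c i * \<delta> (f i))"
proof (induction I rule: infinite_finite_induct)
  case (insert i I)
  then show ?case
    using rat_linear_free_add[of A \<delta> "\<lambda>x. c i * f i x" "\<lambda>x. \<Sum>i\<in>I. c i * f i x"]
    by (simp add: free_rat_sum_closed free_rat_smult_closed rat_linear_free_smult)
qed (simp_all add: rat_linear_free_zero)

lemma rat_linear_free_eq_0: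
  assumes \<delta>: "rat_linear (free_rat A) \<delta>" and gen: "\<And>x. x \<in> A \<Longrightarrow> \<delta> (free_gen x) = 0"
    and f: "f \<in> carrier (free_rat A)"
  shows "\<delta> f = 0"
  using f
proof (induction rule: free_rat_induct)
  case (add f c x)
  then show ?case
    using rat_linear_free_add[OF \<delta> free_rat_smult_closed[OF free_gen_closed]]
      rat_linear_free_smult[OF \<delta> free_gen_closed] gen by simp
qed (rule rat_linear_free_zero[OF \<delta>])

text \<open>Such an \<open>N\<close> is a subspace of the vector space of all rational-valued
  functions. As \<open>g\<close> is outside \<open>N\<close>, a basis of \<open>N\<close> stays
  independent with \<open>g\<close> added, so a linear map can be prescribed as 0 on the basis and 1
  at \<open>g\<close>. It is linear on all functions, which allows any \<open>A\<close>.\<close>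

lemma exists_separating_functional:
  fixes N :: "('a \<Rightarrow> rat) set"
  assumes zero: "(\<lambda>_. 0) \<in> N"
    and add: "\<And>f g. f \<in> N \<Longrightarrow> g \<in> N \<Longrightarrow> (\<lambda>x. f x + g x) \<in> N"
    and smult: "\<And>c f. f \<in> N \<Longrightarrow> (\<lambda>x. c * f x) \<in> N"
    and g: "g \<notin> N"
  obtains \<delta> where "rat_linear (free_rat A) \<delta>" "\<And>f. f \<in> N \<Longrightarrow> \<delta> f = 0" "\<delta> g = 1"
proof -
  let ?s = "\<lambda>(c::rat) (f::'a \<Rightarrow> rat) x. c * f x"
  interpret F: vector_space ?s
    by unfold_locales (auto simp: fun_eq_iff algebra_simps)
  interpret Q: vector_space "(*) :: rat \<Rightarrow> rat \<Rightarrow> rat"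
    by unfold_locales (auto simp: algebra_simps)
  interpret P: vector_space_pair ?s "(*) :: rat \<Rightarrow> rat \<Rightarrow> rat" ..
  have sub: "F.subspace N"
    unfolding F.subspace_def using zero add smult by (auto simp: zero_fun_def plus_fun_def)
  obtain B where B: "B \<subseteq> N" "F.independent B" "N \<subseteq> F.span B"
    using F.maximal_independent_subset by blast
  have "F.span B = N" using B F.span_minimal[OF B(1) sub] by blast
  then have gB: "g \<notin> F.span B" using g by simp
  then obtain \<delta> where \<delta>: "Vector_Spaces.linear ?s (*) \<delta>"
    "\<forall>f\<in>insert g B. \<delta> f = (if f = g then 1 else 0)"
    using P.linear_independent_extend[OF F.independent_insertI[OF gB B(2)],
        of "\<lambda>f. if f = g then 1 else 0"] by blast
  interpret \<delta>: Vector_Spaces.linear ?s "(*)" \<delta> by (rule \<delta>(1))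
  have "\<delta> f = 0" if "f \<in> N" for f
  proof (rule \<delta>.eq_0_on_span)
    show "f \<in> F.span B" using B that by blast
    show "\<delta> b = 0" if "b \<in> B" for b using \<delta>(2) gB F.span_base that by auto
  qed
  moreover have "\<delta> g = 1" using \<delta>(2) by simp
  moreover have "rat_linear (free_rat A) \<delta>"
    unfolding rat_linear_def free_rat_simps
    using \<delta>.add \<delta>.scale by (auto simp: plus_fun_def)
  ultimately show ?thesis using that by blast
qed

section \<open>Duality for tensor products\<close>

lemma bilinear_relations_closed:
  assumes "Module.module rat_ring M" "Module.module rat_ring N"
  shows "bilinear_relations M N \<subseteq> carrier (free_rat (carrier M \<times> carrier N))"
proof -
  interpret M: Module.module rat_ring M by fact
  interpret N: Module.module rat_ring N by fact
  show ?thesis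
    by (auto simp: bilinear_relations_def
        intro!: free_rat_diff_closed free_rat_smult_closed free_gen_closed)
qed

context
  fixes M :: "(rat, 'a, 'm) module_scheme" and N :: "(rat, 'b, 'n) module_scheme"
  assumes M: "Module.module rat_ring M" and N: "Module.module rat_ring N"
begin

lemma bilinear_kernel_submodule:
  "submodule (bilinear_kernel M N) rat_ring (free_rat (carrier M \<times> carrier N))"
  unfolding bilinear_kernel_def
  by (rule submodule_span_submodule[OF free_rat_module bilinear_relations_closed[OF M N]])

lemma tensor_product_module: "Module.module rat_ring (tensor_product M N)"
  unfolding tensor_product_def
  by (rule quotient_module_module[OF free_rat_module bilinear_kernel_submodule])

lemma pure_tensor_closed:
  "x \<in> carrier M \<Longrightarrow> y \<in> carrier N \<Longrightarrow> pure_tensor M N x y \<in> carrier (tensor_product M N)"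
  by (auto simp: tensor_product_def pure_tensor_def free_gen_closed
      quotient_module_carrier[OF free_rat_module bilinear_kernel_submodule])

text \<open>If the span of \<open>S\<close> missed an element, a functional on the free module would
  vanish on the preimage of that span but not on a representative of the element. It kills the
  bilinear relations, so its values on generators form a bilinear form \<beta>, which vanishes on
  \<open>S\<close> and hence, by \<open>dual\<close>, everywhere.\<close>

lemma tensor_product_span_eqI:
  assumes S: "S \<subseteq> carrier (tensor_product M N)"
    and dual: "\<And>\<beta> x y. rat_bilinear M N \<beta> \<Longrightarrow>
      (\<And>x y. x \<in> carrier M \<Longrightarrow> y \<in> carrier N \<Longrightarrow> pure_tensor M N x y \<in> S \<Longrightarrow> \<beta> x y = 0)
      \<Longrightarrow> x \<in> carrier M \<Longrightarrow> y \<in> carrier N \<Longrightarrow> \<beta> x y = 0"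
  shows "submodule_span rat_ring (tensor_product M N) S = carrier (tensor_product M N)"
proof
  interpret M: Module.module rat_ring M by (rule M)
  interpret N: Module.module rat_ring N by (rule N)
  let ?A = "carrier M \<times> carrier N"
  let ?F = "free_rat ?A" and ?K = "bilinear_kernel M N"
  let ?T = "submodule_span rat_ring (tensor_product M N) S"
  note K = bilinear_kernel_submodule and F = free_rat_module[of ?A]
  note T = submodule_span_submodule[OF tensor_product_module S]
  show "?T \<subseteq> carrier (tensor_product M N)" using submodule_subset_carrier[OF T] .
  \<comment> \<open>The preimage in the free module of the span of \<open>S\<close>; it is
    \<open>L\<close> from which \<open>g\<close> gets separated.\<close>
  define L where "L = {f \<in> carrier ?F. ?K +>\<^bsub>?F\<^esub> f \<in> ?T}"
  have KL: "?K \<subseteq> L"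
    using submodule_subset_carrier[OF K] quotient_module_coset_eq_zero[OF F K] submodule_zero[OF T]
    by (auto simp: L_def tensor_product_def quotient_module_zero[OF F K])
  have add: "(\<lambda>x. f x + g x) \<in> L" if "f \<in> L" "g \<in> L" for f g
    using that submodule_add[OF T, of "?K +>\<^bsub>?F\<^esub> f" "?K +>\<^bsub>?F\<^esub> g"]
      quotient_module_add[OF F K, of f g]
    by (simp add: L_def free_rat_add_closed tensor_product_def)
  have smult: "(\<lambda>x. c * f x) \<in> L" if "f \<in> L" for f c
    using that submodule.smult_closed[OF T, of c "?K +>\<^bsub>?F\<^esub> f"]
      quotient_module_smult[OF F K, of c f]
    by (simp add: L_def free_rat_smult_closed tensor_product_def)
  have zero: "(\<lambda>_. 0) \<in> L" using KL submodule_zero[OF K] by auto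
  show "carrier (tensor_product M N) \<subseteq> ?T"
  proof
    fix C assume "C \<in> carrier (tensor_product M N)"
    then obtain g where g: "g \<in> carrier ?F" "C = ?K +>\<^bsub>?F\<^esub> g"
      by (auto simp: tensor_product_def quotient_module_carrier[OF F K])
    show "C \<in> ?T"
    proof (rule ccontr)
      assume "C \<notin> ?T"
      then have "g \<notin> L" using g by (auto simp: L_def)
      then obtain \<delta> where \<delta>: "rat_linear ?F \<delta>" "\<And>f. f \<in> L \<Longrightarrow> \<delta> f = 0" "\<delta> g = 1"
        using exists_separating_functional[of L g ?A] zero add smult by blast
      define \<beta> where "\<beta> x y = \<delta> (free_gen (x, y))" for x y
      note gen = free_gen_closed[of _ ?A]
      have rel: "\<delta> r = 0" if "r \<in> bilinear_relations M N" for r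
        using \<delta>(2) KL hull_inc[OF that] by (auto simp: bilinear_kernel_def submodule_span_def)
      have "\<beta> (x \<oplus>\<^bsub>M\<^esub> x') y = \<beta> x y + \<beta> x' y"
        if "x \<in> carrier M" "x' \<in> carrier M" "y \<in> carrier N" for x x' y
      proof -
        have "(\<lambda>p. free_gen (x \<oplus>\<^bsub>M\<^esub> x', y) p - free_gen (x, y) p - free_gen (x', y) p)
            \<in> bilinear_relations M N"
          using that unfolding bilinear_relations_def by blast
        from rel[OF this] show ?thesis
          using that by (simp add: rat_linear_free_diff[OF \<delta>(1)] free_rat_diff_closed gen \<beta>_def)
      qed
      moreover have "\<beta> x (y \<oplus>\<^bsub>N\<^esub> y') = \<beta> x y + \<beta> x y'"
        if "x \<in> carrier M" "y \<in> carrier N" "y' \<in> carrier N" for x y y'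
      proof -
        have "(\<lambda>p. free_gen (x, y \<oplus>\<^bsub>N\<^esub> y') p - free_gen (x, y) p - free_gen (x, y') p)
            \<in> bilinear_relations M N"
          using that unfolding bilinear_relations_def by blast
        from rel[OF this] show ?thesis
          using that by (simp add: rat_linear_free_diff[OF \<delta>(1)] free_rat_diff_closed gen \<beta>_def)
      qed
      moreover have "\<beta> (c \<odot>\<^bsub>M\<^esub> x) y = c * \<beta> x y" if "x \<in> carrier M" "y \<in> carrier N" for c x y
      proof -
        have "(\<lambda>p. free_gen (c \<odot>\<^bsub>M\<^esub> x, y) p - c * free_gen (x, y) p) \<in> bilinear_relations M N"
          using that unfolding bilinear_relations_def by blast
        from rel[OF this] show ?thesis
          using that by (simp add: rat_linear_free_diff[OF \<delta>(1)] rat_linear_free_smult[OF \<delta>(1)]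
              free_rat_smult_closed gen \<beta>_def)
      qed
      moreover have "\<beta> x (c \<odot>\<^bsub>N\<^esub> y) = c * \<beta> x y" if "x \<in> carrier M" "y \<in> carrier N" for c x y
      proof -
        have "(\<lambda>p. free_gen (x, c \<odot>\<^bsub>N\<^esub> y) p - c * free_gen (x, y) p) \<in> bilinear_relations M N"
          using that unfolding bilinear_relations_def by blast
        from rel[OF this] show ?thesis
          using that by (simp add: rat_linear_free_diff[OF \<delta>(1)] rat_linear_free_smult[OF \<delta>(1)]
              free_rat_smult_closed gen \<beta>_def)
      qed
      ultimately have bil: "rat_bilinear M N \<beta>"
        by (simp add: rat_bilinear_def rat_linear_def)
      have "\<beta> x y = 0"
        if "x \<in> carrier M" "y \<in> carrier N" "pure_tensor M N x y \<in> S" for x y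
      proof -
        have "?K +>\<^bsub>?F\<^esub> free_gen (x, y) \<in> ?T"
          using that(3) hull_inc[of _ S] by (simp add: submodule_span_def pure_tensor_def)
        then show ?thesis using \<delta>(2) that gen by (simp add: L_def \<beta>_def)
      qed
      then have "\<beta> x y = 0" if "x \<in> carrier M" "y \<in> carrier N" for x y
        using dual[OF bil _ that] by blast
      then have "\<delta> (free_gen p) = 0" if "p \<in> ?A" for p
        using that by (auto simp: \<beta>_def)
      then have "\<delta> g = 0" using rat_linear_free_eq_0[OF \<delta>(1) _ g(1)] by blast
      then show False using \<delta>(3) by simp
    qed
  qed
qed

end

section \<open>Steinberg symbols\<close>

text \<open>
  A locale of its own, because constants defined in \<open>vector_space\<close> itself would be captured by
  its global interpretation for real vector spaces.
\<close>

locale ambient_space = vector_space scale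
  for scale :: "'f::field \<Rightarrow> 'b::ab_group_add \<Rightarrow> 'b" (infixr "*s" 75)
begin

section \<open>Finite-dimensional subspaces and hyperplanes\<close>

definition findim_subspace :: "'b set \<Rightarrow> bool"
  where "findim_subspace V \<longleftrightarrow> subspace V \<and> (\<exists>B. finite B \<and> V = span B)"

lemma findim_subspace_basis:
  assumes "findim_subspace V"
  obtains B where "finite B" "independent B" "span B = V" "card B = dim V"
proof -
  obtain S where S: "finite S" "V = span S" and sub: "subspace V"
    using assms by (auto simp: findim_subspace_def)
  obtain B where B: "B \<subseteq> V" "independent B" "V \<subseteq> span B" "card B = dim V"
    using basis_exists by blast
  have "finite B"
    using independent_span_bound[OF S(1) B(2)] B(1) S(2) by blast
  moreover have "span B = V"
    using B span_minimal[OF B(1) sub] by blast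
  ultimately show ?thesis using that B by blast
qed

lemma independent_card_le_dim:
  assumes "findim_subspace V" "independent S" "S \<subseteq> V"
  shows "finite S \<and> card S \<le> dim V"
  by (metis assms findim_subspace_basis independent_span_bound)

lemma independent_card_eq_dim_spans:
  assumes V: "findim_subspace V" and S: "independent S" "S \<subseteq> V" and card: "card S = dim V"
  shows "span S = V"
proof
  have sub: "subspace V" using V by (simp add: findim_subspace_def)
  show "span S \<subseteq> V" using span_minimal[OF S(2) sub] .
  show "V \<subseteq> span S"
  proof
    fix v assume v: "v \<in> V"
    show "v \<in> span S"
    proof (rule ccontr)
      assume n: "v \<notin> span S"
      then have "independent (insert v S)" using S(1) independent_insertI by blast
      then have "card (insert v S) \<le> dim V"
        using independent_card_le_dim[OF V] S(2) v by blast
      moreover have "v \<notin> S" using n span_base by blast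
      moreover have "finite S" using independent_card_le_dim[OF V S] by blast
      ultimately show False using card by simp
    qed
  qed
qed

lemma hyperplane_subspace:
  assumes "hyperplane scale V K" shows "subspace K" "K \<subseteq> V" "dim V = Suc (dim K)"
  using assms by (auto simp: hyperplane_def)

lemma hyperplane_findim:
  assumes V: "findim_subspace V" and K: "hyperplane scale V K"
  shows "findim_subspace K"
proof -
  obtain B where B: "B \<subseteq> K" "independent B" "K \<subseteq> span B" "card B = dim K"
    using basis_exists by blast
  have "finite B"
    using independent_card_le_dim[OF V B(2)] B(1) hyperplane_subspace[OF K] by blast
  moreover have "K = span B"
    using B span_minimal[OF B(1) hyperplane_subspace(1)[OF K]] by blast
  ultimately show ?thesis
    using hyperplane_subspace(1)[OF K] unfolding findim_subspace_def by blast
qed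

text \<open>A basis of \<open>K\<close> together with \<open>m\<close> is independent and has
  \<open>dim V\<close> elements. Any other spanning set \<open>B\<close> may replace the basis,
  since the span of \<open>insert m B\<close> depends only on the span of \<open>B\<close>.\<close>

lemma span_insert_hyperplane:
  assumes V: "findim_subspace V" and K: "hyperplane scale V K" and m: "m \<in> V - K"
    and B: "span B = K"
  shows "span (insert m B) = V"
proof -
  obtain C where C: "finite C" "independent C" "span C = K" "card C = dim K"
    using findim_subspace_basis[OF hyperplane_findim[OF V K]] .
  have "independent (insert m C)" using m C independent_insertI by blast
  moreover have "insert m C \<subseteq> V"
    using m C(3) hyperplane_subspace(2)[OF K] span_superset by blast
  moreover have "card (insert m C) = dim V"
    using m C span_base hyperplane_subspace(3)[OF K] by (subst card_insert_disjoint) auto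
  ultimately have "span (insert m C) = V" by (rule independent_card_eq_dim_spans[OF V])
  then show ?thesis using B C(3) by (metis span_insert)
qed

lemma hyperplane_decompose:
  assumes "findim_subspace V" "hyperplane scale V K" "m \<in> V - K" "v \<in> V"
  obtains c where "v - c *s m \<in> K"
proof -
  have sub: "subspace K" using assms(2) by (rule hyperplane_subspace)
  then have "v \<in> span (insert m K)"
    using span_insert_hyperplane[OF assms(1-3), of K] assms(4) by simp
  moreover have "span K = K" using sub by simp
  ultimately show ?thesis using that by (auto simp: span_breakdown_eq)
qed

text \<open>For an independent tuple of full length with last entry \<open>n\<close>, this provides
  the span of the remaining entries as the hyperplane to which the induction descends.\<close>

lemma hyperplane_span_butlast:
  assumes V: "findim_subspace V" and ks: "set ks \<subseteq> V" "n \<in> V" "length ks = dim V - 1" "dim V > 0"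
    and ind: "distinct (ks @ [n])" "independent (set (ks @ [n]))"
  shows "hyperplane scale V (span (set ks))" "n \<notin> span (set ks)"
proof -
  have sub: "subspace V" using V by (simp add: findim_subspace_def)
  have "independent (insert n (set ks))" "n \<notin> set ks" using ind by auto
  then have i: "independent (set ks)" "n \<notin> span (set ks)"
    by (auto simp: independent_insert)
  then show "n \<notin> span (set ks)" by blast
  have "dim (span (set ks)) = length ks"
    using i(1) ind(1) by (simp add: dim_eq_card_independent distinct_card)
  then show "hyperplane scale V (span (set ks))"
    unfolding hyperplane_def using ks span_minimal[OF ks(1) sub] by simp
qed

section \<open>Symbols on a single space\<close>

text \<open>The dual form of the apartment presentation: these are the conditions satisfied by the
  values of a linear functional on \<open>steinberg\<close> at the apartments.\<close>

definition steinberg_symbol :: "'b set \<Rightarrow> ('b list \<Rightarrow> rat) \<Rightarrow> bool"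
  where "steinberg_symbol V \<phi> \<longleftrightarrow>
    (\<forall>vs \<in> nonzero_tuples V (dim V).
      (\<not> distinct vs \<or> dependent (set vs) \<longrightarrow> \<phi> vs = 0) \<and>
      (\<forall>i < dim V. \<forall>j < dim V. i \<noteq> j \<longrightarrow> \<phi> (vs[i := vs ! j, j := vs ! i]) = - \<phi> vs) \<and>
      (\<forall>i < dim V. \<forall>c. c \<noteq> 0 \<longrightarrow> \<phi> (vs[i := c *s vs ! i]) = \<phi> vs)) \<and>
    (\<forall>vs \<in> nonzero_tuples V (Suc (dim V)).
      (\<Sum>i\<le>dim V. (- 1) ^ i * \<phi> (take i vs @ drop (Suc i) vs)) = 0)"

lemma steinberg_symbol_degenerate:
  "steinberg_symbol V \<phi> \<Longrightarrow> vs \<in> nonzero_tuples V (dim V) \<Longrightarrow> \<not> distinct vs \<or> dependent (set vs)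
    \<Longrightarrow> \<phi> vs = 0"
  by (auto simp: steinberg_symbol_def)

lemma steinberg_symbol_swap:
  "steinberg_symbol V \<phi> \<Longrightarrow> vs \<in> nonzero_tuples V (dim V) \<Longrightarrow> i < dim V \<Longrightarrow> j < dim V \<Longrightarrow> i \<noteq> j
    \<Longrightarrow> \<phi> (vs[i := vs ! j, j := vs ! i]) = - \<phi> vs"
  by (auto simp: steinberg_symbol_def)

lemma steinberg_symbol_scale:
  "steinberg_symbol V \<phi> \<Longrightarrow> vs \<in> nonzero_tuples V (dim V) \<Longrightarrow> i < dim V \<Longrightarrow> c \<noteq> 0
    \<Longrightarrow> \<phi> (vs[i := c *s vs ! i]) = \<phi> vs"
  by (auto simp: steinberg_symbol_def)

lemma steinberg_symbol_cocycle:
  "steinberg_symbol V \<phi> \<Longrightarrow> vs \<in> nonzero_tuples V (Suc (dim V))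
    \<Longrightarrow> (\<Sum>i\<le>dim V. (- 1) ^ i * \<phi> (take i vs @ drop (Suc i) vs)) = 0"
  by (auto simp: steinberg_symbol_def)

lemma nonzero_tuples_omit:
  assumes "vs \<in> nonzero_tuples V n" "i < n"
  shows "take i vs @ drop (Suc i) vs \<in> nonzero_tuples V (n - 1)"
  using assms set_take_subset[of i vs] set_drop_subset[of "Suc i" vs]
  by (auto simp: nonzero_tuples_def)

lemma nonzero_tuples_mono:
  "K \<subseteq> V \<Longrightarrow> vs \<in> nonzero_tuples K n \<Longrightarrow> vs \<in> nonzero_tuples V n"
  by (auto simp: nonzero_tuples_def)

lemma nonzero_tuples_update:
  "vs \<in> nonzero_tuples V n \<Longrightarrow> v \<in> V - {0} \<Longrightarrow> vs[i := v] \<in> nonzero_tuples V n"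
  using set_update_subset_insert[of vs i v] by (auto simp: nonzero_tuples_def)

lemma nonzero_tuples_nth:
  "vs \<in> nonzero_tuples V n \<Longrightarrow> i < n \<Longrightarrow> vs ! i \<in> V - {0}"
  unfolding nonzero_tuples_def using nth_mem[of i vs] by blast

text \<open>The cocycle relation for \<open>vs @ [m]\<close> writes \<phi> at \<open>vs\<close> as a
  signed sum of its values at tuples ending in \<open>m\<close>. Dually, the apartments with last
  entry \<open>m\<close> generate; only the independent ones contribute.\<close>

lemma steinberg_symbol_eq_0_last:
  assumes \<phi>: "steinberg_symbol V \<phi>" and m: "m \<in> V - {0}"
    and zero: "\<And>ks. ks \<in> nonzero_tuples V (dim V - 1) \<Longrightarrow> distinct (ks @ [m])
      \<Longrightarrow> independent (set (ks @ [m])) \<Longrightarrow> \<phi> (ks @ [m]) = 0"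
    and vs: "vs \<in> nonzero_tuples V (dim V)"
  shows "\<phi> vs = 0"
proof -
  let ?d = "dim V" and ?us = "vs @ [m]"
  have len: "length vs = ?d" using vs by (simp add: nonzero_tuples_def)
  have "?us \<in> nonzero_tuples V (Suc ?d)" using vs m by (auto simp: nonzero_tuples_def)
  then have "(\<Sum>i\<le>?d. (- 1) ^ i * \<phi> (take i ?us @ drop (Suc i) ?us)) = 0"
    by (rule steinberg_symbol_cocycle[OF \<phi>])
  moreover have "\<phi> (take i ?us @ drop (Suc i) ?us) = 0" if i: "i < ?d" for i
  proof -
    let ?ks = "take i vs @ drop (Suc i) vs"
    have ks: "?ks \<in> nonzero_tuples V (?d - 1)" using nonzero_tuples_omit[OF vs i] .
    then have "?ks @ [m] \<in> nonzero_tuples V ?d" using m i by (auto simp: nonzero_tuples_def)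
    then have "\<phi> (?ks @ [m]) = 0"
      using zero[OF ks] steinberg_symbol_degenerate[OF \<phi>] by blast
    then show ?thesis using i len by simp
  qed
  \<comment> \<open>The term of index \<open>dim V\<close> omits the appended \<open>m\<close> and
    leaves \<open>vs\<close>.\<close>
  ultimately have "(- 1) ^ ?d * \<phi> vs = 0"
    using len by (simp add: sum.lessThan_Suc[symmetric] lessThan_Suc_atMost[symmetric])
  then show ?thesis by simp
qed

text \<open>Either \<open>h\<close> already occurs in \<open>us\<close>, or it is a new vector in
  the span of the others. The disjunction is the form in which
  \<open>steinberg_symbol_degenerate\<close> expects degeneracy.\<close>

lemma degenerate_Cons:
  "h \<in> span (set us) \<Longrightarrow> \<not> distinct (h # us) \<or> dependent (set (h # us))"
  by (auto simp: independent_insert split: if_splits)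

text \<open>
  If two entries lie outside \<open>H\<close>, their span meets \<open>H\<close> in a line spanned by some \<open>h\<close>. In the
  cocycle relation for \<open>h # vs\<close> only the terms omitting one of these two entries survive, and
  each of them has one entry fewer outside \<open>H\<close>.
\<close>

lemma steinberg_symbol_eq_0_hyperplane:
  assumes \<phi>: "steinberg_symbol V \<phi>" and V: "findim_subspace V" and H: "hyperplane scale V H"
    and zero: "\<And>hs l. hs \<in> nonzero_tuples H (dim V - 1) \<Longrightarrow> l \<in> V - H \<Longrightarrow> \<phi> (hs @ [l]) = 0"
    and vs: "vs \<in> nonzero_tuples V (dim V)"
  shows "\<phi> vs = 0"
  using vs
proof (induction "length (filter (\<lambda>v. v \<notin> H) vs)" arbitrary: vs rule: less_induct)
  case less
  let ?d = "dim V"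
  have d: "?d = Suc (dim H)" using hyperplane_subspace[OF H] by blast
  have len: "length vs = ?d" using less.prems by (simp add: nonzero_tuples_def)
  have nz: "v \<in> V" "v \<noteq> 0" if "v \<in> set vs" for v
    using less.prems that by (auto simp: nonzero_tuples_def)
  have split: "vs = take k vs @ vs ! k # drop (Suc k) vs" if "k < ?d" for k
    using that len by (simp add: id_take_nth_drop)
  show ?case
  proof (cases "\<not> distinct vs \<or> dependent (set vs)")
    case True
    then show ?thesis using steinberg_symbol_degenerate[OF \<phi> less.prems] by blast
  next
    case False
    then have dist: "distinct vs" and ind: "independent (set vs)" by auto
    consider i j where "i < ?d" "j < ?d" "i \<noteq> j" "vs ! i \<notin> H" "vs ! j \<notin> H"
      | i where "i < ?d" "vs ! i \<notin> H" "\<And>j. j < ?d \<Longrightarrow> j \<noteq> i \<Longrightarrow> vs ! j \<in> H"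
      | "\<And>i. i < ?d \<Longrightarrow> vs ! i \<in> H"
      by blast
    then show ?thesis
    proof cases
      case (1 i j)
      let ?x = "vs ! i" and ?y = "vs ! j"
      have xy: "?x \<in> set vs" "?y \<in> set vs" "?x \<noteq> ?y"
        using 1 len dist by (auto simp: nth_eq_iff_index_eq)
      obtain c where c: "?y - c *s ?x \<in> H"
        using hyperplane_decompose[OF V H] xy nz 1 by blast
      define h where "h = ?y - c *s ?x"
      have hspan: "h \<in> span S" if "?x \<in> S" "?y \<in> S" for S
        unfolding h_def using that by (intro span_diff span_scale span_base)
      have "h \<noteq> 0"
      proof
        assume "h = 0"
        then have "?y = c *s ?x" by (simp add: h_def)
        moreover have "c *s ?x \<in> span (set vs - {?y})"
          using xy by (intro span_scale span_base) auto
        ultimately show False using ind xy unfolding dependent_def by metis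
      qed
      moreover have hH: "h \<in> H" using c h_def by simp
      ultimately have hV: "h \<in> V - {0}" using hyperplane_subspace[OF H] by blast
      have us: "h # vs \<in> nonzero_tuples V (Suc ?d)"
        using less.prems hV by (auto simp: nonzero_tuples_def)
      have omit: "\<phi> (h # take k vs @ drop (Suc k) vs) = 0" if k: "k < ?d" for k
      proof -
        let ?us = "take k vs @ drop (Suc k) vs"
        have tup: "h # ?us \<in> nonzero_tuples V ?d"
          using nonzero_tuples_omit[OF less.prems k] hV k by (auto simp: nonzero_tuples_def)
        show ?thesis
        proof (cases "k = i \<or> k = j")
          case True
          then have "vs ! k \<notin> H" using 1 by auto
          moreover have "length (filter (\<lambda>v. v \<notin> H) vs)
              = length (filter (\<lambda>v. v \<notin> H) (take k vs @ vs ! k # drop (Suc k) vs))"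
            using split[OF k] by (rule arg_cong)
          ultimately have
            "length (filter (\<lambda>v. v \<notin> H) (h # ?us)) < length (filter (\<lambda>v. v \<notin> H) vs)"
            using hH by simp
          then show ?thesis using less.hyps tup by blast
        next
          case False
          \<comment> \<open>Both \<open>?x\<close> and \<open>?y\<close> survive the omission, so
            \<open>h\<close> lies in the span of the remaining entries.\<close>
          have "set vs = set (take k vs @ vs ! k # drop (Suc k) vs)"
            using split[OF k] by (rule arg_cong)
          then have "set vs = insert (vs ! k) (set ?us)" by simp
          moreover have "vs ! k \<noteq> ?x" "vs ! k \<noteq> ?y"
            using False dist k 1 len by (auto simp: nth_eq_iff_index_eq)
          ultimately have "?x \<in> set ?us" "?y \<in> set ?us" using xy(1,2) by auto
          then have "h \<in> span (set ?us)" by (rule hspan)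
          then show ?thesis
            by (rule steinberg_symbol_degenerate[OF \<phi> tup degenerate_Cons])
        qed
      qed
      have "(\<Sum>i\<le>?d. (- 1) ^ i * \<phi> (take i (h # vs) @ drop (Suc i) (h # vs))) = 0"
        using steinberg_symbol_cocycle[OF \<phi> us] .
      \<comment> \<open>The term of index 0 omits \<open>h\<close> and is \<phi> at
        \<open>vs\<close>; all later terms vanish by \<open>omit\<close>, whose index
        \<open>k\<close> is shifted by one.\<close>
      then show ?thesis using omit unfolding d by (simp add: sum.atMost_Suc_shift del: sum.atMost_Suc)
    next
      case (2 i)
      \<comment> \<open>The only entry outside \<open>H\<close> is exchanged with the last one, at
        the cost of a sign. The case where it is already last is separate because the exchange
        relation asks for two different positions.\<close>
      define ws where "ws = (if i = ?d - 1 then vs else vs[i := vs ! (?d - 1), ?d - 1 := vs ! i])"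
      have eq: "\<phi> ws = \<phi> vs \<or> \<phi> ws = - \<phi> vs"
        using steinberg_symbol_swap[OF \<phi> less.prems 2(1), of "?d - 1"] d by (auto simp: ws_def)
      have lw: "length ws = ?d" using len by (simp add: ws_def)
      then have ne: "ws \<noteq> []" using d by auto
      have last: "last ws = vs ! i"
        using lw len d 2(1) ne by (auto simp: ws_def last_conv_nth)
      have "butlast ws ! k \<in> H - {0}" if k: "k < ?d - 1" for k
      proof -
        have "butlast ws ! k = ws ! k" using k lw by (simp add: nth_butlast)
        also have "\<dots> = (if i = k then vs ! (?d - 1) else vs ! k)"
          using k len 2(1) by (auto simp: ws_def nth_list_update)
        finally show ?thesis
          using 2 k d len nz[of "vs ! k"] nz[of "vs ! (?d - 1)"] by (auto split: if_splits)
      qed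
      then have "butlast ws \<in> nonzero_tuples H (?d - 1)"
        using lw by (auto simp: nonzero_tuples_def in_set_conv_nth)
      moreover have "last ws \<in> V - H" using last 2 len nz by auto
      ultimately have "\<phi> (butlast ws @ [last ws]) = 0" by (rule zero)
      then show ?thesis using eq ne by auto
    next
      case 3
      \<comment> \<open>There is no room in \<open>H\<close> for \<open>dim V\<close> independent
        vectors, since its dimension is one less.\<close>
      then have "set vs \<subseteq> H" using len by (auto simp: in_set_conv_nth)
      then have "card (set vs) \<le> dim H"
        using independent_card_le_dim[OF hyperplane_findim[OF V H] ind] by blast
      then show ?thesis using dist len d by (simp add: distinct_card)
    qed
  qed
qed

text \<open>Each relation for \<open>vs\<close> in \<open>K\<close> comes from one for
  \<open>vs @ [m]\<close> in \<open>V\<close>. Only the cocycle relation has an extra term, the one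
  omitting \<open>m\<close>: it is \<phi> at \<open>dim K + 1\<close> vectors of \<open>K\<close>,
  which are repeated or dependent, hence 0.\<close>

lemma steinberg_symbol_restrict:
  assumes \<phi>: "steinberg_symbol V \<phi>" and V: "findim_subspace V" and K: "hyperplane scale V K"
    and m: "m \<in> V - K"
  shows "steinberg_symbol K (\<lambda>vs. \<phi> (vs @ [m]))"
proof -
  note sub = hyperplane_subspace[OF K]
  have m0: "m \<noteq> 0" using m sub(1) subspace_0 by blast
  have tup: "vs @ [m] \<in> nonzero_tuples V (Suc n)" if "vs \<in> nonzero_tuples K n" for vs n
    using that m m0 sub(2) by (auto simp: nonzero_tuples_def)
  have "\<phi> (vs @ [m]) = 0"
    if "vs \<in> nonzero_tuples K (dim K)" "\<not> distinct vs \<or> dependent (set vs)" for vs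
  proof -
    have "\<not> distinct (vs @ [m]) \<or> dependent (set (vs @ [m]))"
      using that(2) by (auto simp: independent_insert split: if_splits)
    then show ?thesis using steinberg_symbol_degenerate[OF \<phi>] tup[OF that(1)] sub(3) by metis
  qed
  moreover have "\<phi> (vs[i := vs ! j, j := vs ! i] @ [m]) = - \<phi> (vs @ [m])"
    if "vs \<in> nonzero_tuples K (dim K)" "i < dim K" "j < dim K" "i \<noteq> j" for vs i j
  proof -
    have "length vs = dim K" using that by (simp add: nonzero_tuples_def)
    then show ?thesis
      using steinberg_symbol_swap[OF \<phi>, of "vs @ [m]" i j] tup[OF that(1)] sub(3) that
      by (simp add: nth_append list_update_append)
  qed
  moreover have "\<phi> (vs[i := c *s vs ! i] @ [m]) = \<phi> (vs @ [m])"
    if "vs \<in> nonzero_tuples K (dim K)" "i < dim K" "c \<noteq> 0" for vs i c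
  proof -
    have "length vs = dim K" using that by (simp add: nonzero_tuples_def)
    then show ?thesis
      using steinberg_symbol_scale[OF \<phi>, of "vs @ [m]" i c] tup[OF that(1)] sub(3) that
      by (simp add: nth_append list_update_append)
  qed
  moreover have "(\<Sum>i\<le>dim K. (- 1) ^ i * \<phi> ((take i vs @ drop (Suc i) vs) @ [m])) = 0"
    if vs: "vs \<in> nonzero_tuples K (Suc (dim K))" for vs
  proof -
    have len: "length vs = Suc (dim K)" using vs by (simp add: nonzero_tuples_def)
    have "\<not> distinct vs \<or> dependent (set vs)"
    proof (rule ccontr)
      assume "\<not> ?thesis"
      then have "card (set vs) \<le> dim K" "card (set vs) = Suc (dim K)"
        using independent_card_le_dim[OF hyperplane_findim[OF V K], of "set vs"] vs
        by (auto simp: nonzero_tuples_def distinct_card)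
      then show False by simp
    qed
    moreover have "vs \<in> nonzero_tuples V (dim V)"
      using nonzero_tuples_mono[OF sub(2) vs] sub(3) by simp
    ultimately have "\<phi> vs = 0" using steinberg_symbol_degenerate[OF \<phi>] by blast
    then show ?thesis
      using steinberg_symbol_cocycle[OF \<phi>, of "vs @ [m]"] tup[OF vs] sub(3) len by simp
  qed
  ultimately show ?thesis unfolding steinberg_symbol_def by blast
qed

section \<open>Pairs of symbols and Coxeter tuples\<close>

definition steinberg_bisymbol :: "'b set \<Rightarrow> ('b list \<Rightarrow> 'b list \<Rightarrow> rat) \<Rightarrow> bool"
  where "steinberg_bisymbol V \<phi> \<longleftrightarrow>
    (\<forall>ws \<in> nonzero_tuples V (dim V). steinberg_symbol V (\<lambda>vs. \<phi> vs ws)) \<and>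
    (\<forall>vs \<in> nonzero_tuples V (dim V). steinberg_symbol V (\<phi> vs))"

text \<open>Coxeter pairs written with a generating vector for each line. Equality of the first
  vectors is stronger than equality of their lines; this suffices, since only the passage from these
  tuples to Coxeter pairs of lines is used.\<close>

definition coxeter_tuples :: "'b set \<Rightarrow> 'b list \<Rightarrow> 'b list \<Rightarrow> bool"
  where "coxeter_tuples V ps qs \<longleftrightarrow>
    ps \<in> nonzero_tuples V (dim V) \<and> qs \<in> nonzero_tuples V (dim V) \<and>
    span (set ps) = V \<and> span (set qs) = V \<and>
    (0 < dim V \<longrightarrow> ps ! 0 = qs ! 0) \<and>
    (\<forall>i. 1 \<le> i \<and> i < dim V \<longrightarrow> qs ! i \<in> span {ps ! (i - 1), ps ! i})"

lemma steinberg_bisymbol_restrict: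
  assumes \<phi>: "steinberg_bisymbol V \<phi>" and V: "findim_subspace V" and K: "hyperplane scale V K"
    and m: "m \<in> V - K" and l: "l \<in> V - K"
  shows "steinberg_bisymbol K (\<lambda>vs ws. \<phi> (vs @ [m]) (ws @ [l]))"
proof -
  note sub = hyperplane_subspace[OF K]
  have tup: "vs @ [x] \<in> nonzero_tuples V (dim V)"
    if "vs \<in> nonzero_tuples K (dim K)" "x \<in> V - K" for vs x
  proof -
    have "x \<noteq> 0" using that sub(1) subspace_0 by blast
    then show ?thesis using that sub by (auto simp: nonzero_tuples_def)
  qed
  show ?thesis
    unfolding steinberg_bisymbol_def
    using \<phi> tup m l steinberg_symbol_restrict[OF _ V K, of "\<phi> (_ @ [m])" l]
      steinberg_symbol_restrict[OF _ V K, of "\<lambda>vs. \<phi> vs (_ @ [l])" m]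
    by (auto simp: steinberg_bisymbol_def)
qed

text \<open>The only new condition concerns position \<open>dim K\<close>, where \<open>l\<close>
  has to lie in the span of \<open>last ps\<close> and \<open>m\<close>. If
  \<open>dim K = 0\<close>, the appended entries are the first ones and have to be equal, so the
  second alternative in \<open>lm\<close> excludes this case.\<close>

lemma coxeter_tuples_snoc:
  assumes c: "coxeter_tuples K ps qs" and V: "findim_subspace V" and K: "hyperplane scale V K"
    and m: "m \<in> V - K" and l: "l \<in> V - K"
    and lm: "l = m \<or> dim K \<noteq> 0 \<and> l \<in> span {last ps, m}"
  shows "coxeter_tuples V (ps @ [m]) (qs @ [l])"
proof -
  note sub = hyperplane_subspace[OF K]
  have nz: "m \<noteq> 0" "l \<noteq> 0" using m l sub(1) subspace_0 by blast+
  have len: "length ps = dim K" "length qs = dim K"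
    using c by (auto simp: coxeter_tuples_def nonzero_tuples_def)
  have sp: "span (insert x (set us)) = V" if "x \<in> V - K" "span (set us) = K" for x us
    using span_insert_hyperplane[OF V K that] .
  have "(qs @ [l]) ! i \<in> span {(ps @ [m]) ! (i - 1), (ps @ [m]) ! i}"
    if i: "1 \<le> i" "i < dim V" for i
  proof (cases "i < dim K")
    case True
    then have "(ps @ [m]) ! (i - 1) = ps ! (i - 1)" "(ps @ [m]) ! i = ps ! i"
      "(qs @ [l]) ! i = qs ! i"
      using i len by (auto simp: nth_append)
    then show ?thesis using c i True by (simp add: coxeter_tuples_def)
  next
    case False
    then have "i = dim K" "ps \<noteq> []" using i sub(3) len by auto
    moreover from this have "l \<in> span {last ps, m}"
      using lm by (auto intro: span_base)
    ultimately show ?thesis using i len by (auto simp: nth_append last_conv_nth)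
  qed
  moreover have "(ps @ [m]) ! 0 = (qs @ [l]) ! 0"
    using c lm len by (cases "dim K = 0") (auto simp: coxeter_tuples_def nth_append)
  ultimately show ?thesis
    using c m l nz sub sp[OF m, of ps] sp[OF l, of qs]
    by (auto simp: coxeter_tuples_def nonzero_tuples_def)
qed

text \<open>
  The premise \<open>rec\<close> is the induction hypothesis: the conclusion of
  \<open>steinberg_bisymbol_eq_0_last\<close> below for the hyperplane \<open>K\<close>.
\<close>

lemma steinberg_bisymbol_eq_0_hyperplane:
  assumes \<phi>: "steinberg_bisymbol V \<phi>" and V: "findim_subspace V" and K: "hyperplane scale V K"
    and m: "m \<in> V - K" and l: "l \<in> V - K"
    and zero: "\<And>ps qs. ps \<in> nonzero_tuples K (dim K) \<Longrightarrow> coxeter_tuples V (ps @ [m]) qs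
      \<Longrightarrow> \<phi> (ps @ [m]) qs = 0"
    and rec: "\<And>n \<psi> vs ws. n \<in> K - {0} \<Longrightarrow> steinberg_bisymbol K \<psi>
      \<Longrightarrow> (\<And>ps qs. coxeter_tuples K ps qs \<Longrightarrow> last ps = n \<Longrightarrow> \<psi> ps qs = 0)
      \<Longrightarrow> vs \<in> nonzero_tuples K (dim K) \<Longrightarrow> ws \<in> nonzero_tuples K (dim K) \<Longrightarrow> \<psi> vs ws = 0"
    and vs: "vs \<in> nonzero_tuples K (dim K)" and ws: "ws \<in> nonzero_tuples K (dim K)"
  shows "\<phi> (vs @ [m]) (ws @ [l]) = 0"
proof -
  note sub = hyperplane_subspace[OF K]
  have nz: "m \<noteq> 0" "l \<noteq> 0" using m l sub(1) subspace_0 by blast+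
  have Kf: "findim_subspace K" using hyperplane_findim[OF V K] .
  \<comment> \<open>This vector is 0 exactly if \<open>l\<close> and \<open>m\<close> are parallel;
    otherwise it spans the line in which the span of \<open>l\<close> and \<open>m\<close> meets
    \<open>K\<close>.\<close>
  obtain c where c: "l - c *s m \<in> K" using hyperplane_decompose[OF V K m] l by blast
  show ?thesis
  proof (cases "l - c *s m = 0")
    case True
    then have lc: "l = c *s m" "c \<noteq> 0" using nz by auto
    have "vs @ [m] \<in> nonzero_tuples V (dim V)" "ws @ [m] \<in> nonzero_tuples V (dim V)"
      using vs ws m nz sub by (auto simp: nonzero_tuples_def)
    moreover have "length ws = dim K" using ws by (simp add: nonzero_tuples_def)
    \<comment> \<open>Position \<open>dim K\<close> is that of the appended entry; the scaling
      relation there turns \<open>m\<close> into \<open>l\<close>.\<close>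
    ultimately have eq: "\<phi> (vs @ [m]) (ws @ [l]) = \<phi> (vs @ [m]) (ws @ [m])"
      using \<phi> steinberg_symbol_scale[of V "\<phi> (vs @ [m])" "ws @ [m]" "dim K" c] lc sub(3)
      by (simp add: steinberg_bisymbol_def list_update_append nth_append)
    have cox: "\<phi> (ps @ [m]) (qs @ [m]) = 0" if "coxeter_tuples K ps qs" for ps qs
      using zero coxeter_tuples_snoc[OF that V K m m] that by (auto simp: coxeter_tuples_def)
    show ?thesis
    proof (cases "dim K = 0")
      case True
      \<comment> \<open>In dimension 0 there is no nonzero point to feed to \<open>rec\<close>, but
        the pair of empty tuples is itself a Coxeter pair.\<close>
      then have "K = {0}"
        using findim_subspace_basis[OF Kf] by (metis card_0_eq span_empty)
      then have "coxeter_tuples K [] []"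
        using True by (auto simp: coxeter_tuples_def nonzero_tuples_def)
      moreover have "vs = []" "ws = []" using vs ws True by (auto simp: nonzero_tuples_def)
      ultimately show ?thesis using cox eq by metis
    next
      case False
      \<comment> \<open>By \<open>cox\<close> the form vanishes on all Coxeter pairs of
        \<open>K\<close>, so any nonzero point of \<open>K\<close> will do for \<open>rec\<close>;
        the first entry of \<open>vs\<close> supplies one.\<close>
      then obtain v vs' where "vs = v # vs'" using vs by (cases vs) (auto simp: nonzero_tuples_def)
      then have "v \<in> K - {0}" using vs by (auto simp: nonzero_tuples_def)
      then show ?thesis
        using rec[OF _ steinberg_bisymbol_restrict[OF \<phi> V K m m] cox vs ws] eq by auto
    qed
  next
    case False
    let ?n = "l - c *s m"
    have n: "?n \<in> K - {0}" using c False by blast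
    have d: "dim K \<noteq> 0"
      using n findim_subspace_basis[OF Kf] by (metis DiffE card_0_eq span_empty)
    have "l = ?n + c *s m" by simp
    then have l_span: "l \<in> span {?n, m}"
      by (metis insertI1 insertI2 span_add span_base span_scale)
    \<comment> \<open>With \<open>?n\<close> as the point prescribed in \<open>rec\<close>, only
      pairs with \<open>last ps = ?n\<close> have to be extended, and for these \<open>l\<close>
      lies in the span of \<open>last ps\<close> and \<open>m\<close>.\<close>
    have "\<phi> (ps @ [m]) (qs @ [l]) = 0" if "coxeter_tuples K ps qs" "last ps = ?n" for ps qs
      using zero coxeter_tuples_snoc[OF that(1) V K m l] that l_span d
      by (auto simp: coxeter_tuples_def)
    then show ?thesis
      using rec[OF n steinberg_bisymbol_restrict[OF \<phi> V K m l] _ vs ws] by blast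
  qed
qed

text \<open>The induction on the dimension has to leave the point \<open>n\<close> and the form
  \<phi> arbitrary: on the hyperplane spanned by the entries before \<open>n\<close>, both the new
  point and the restricted form depend on the vector \<open>l\<close> appended in the second
  factor.\<close>

lemma steinberg_bisymbol_eq_0_last:
  assumes "steinberg_bisymbol V \<phi>" "findim_subspace V" "n \<in> V - {0}"
    and "\<And>ps qs. coxeter_tuples V ps qs \<Longrightarrow> last ps = n \<Longrightarrow> \<phi> ps qs = 0"
    and "vs \<in> nonzero_tuples V (dim V)" "ws \<in> nonzero_tuples V (dim V)"
  shows "\<phi> vs ws = 0"
  using assms
proof (induction "dim V" arbitrary: V \<phi> n vs ws)
  case 0
  \<comment> \<open>No nonzero \<open>n\<close> exists in dimension 0, so there is nothing to
    prove.\<close>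
  then have "V = {0}"
    using findim_subspace_basis[of V] by (metis card_0_eq span_empty)
  then show ?case using 0 by blast
next
  case (Suc d)
  note \<phi> = Suc.prems(1) and V = Suc.prems(2) and n = Suc.prems(3)
  have d: "dim V - 1 = d" "dim V > 0" using Suc.hyps(2) by auto
  have "\<phi> (ks @ [n]) ws = 0"
    if ks: "ks \<in> nonzero_tuples V (dim V - 1)"
      and ind: "distinct (ks @ [n])" "independent (set (ks @ [n]))" for ks
  proof -
    let ?K = "span (set ks)"
    have ks': "set ks \<subseteq> V" "n \<in> V" "length ks = dim V - 1"
      using ks n by (auto simp: nonzero_tuples_def)
    have K: "hyperplane scale V ?K" and nK: "n \<in> V - ?K"
      using hyperplane_span_butlast[OF V ks' d(2) ind] n by auto
    have dK: "dim ?K = d" using hyperplane_subspace(3)[OF K] d by simp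
    have ksK: "ks \<in> nonzero_tuples ?K (dim ?K)"
      using ks dK d span_superset[of "set ks"] unfolding nonzero_tuples_def by auto
    have tup: "ks @ [n] \<in> nonzero_tuples V (dim V)"
      using ks n d by (auto simp: nonzero_tuples_def)
    then have sym: "steinberg_symbol V (\<phi> (ks @ [n]))"
      using \<phi> by (simp add: steinberg_bisymbol_def)
    \<comment> \<open>The second factor is expanded with respect to a hyperplane that depends on the
      first one.\<close>
    have "\<phi> (ks @ [n]) (hs @ [l]) = 0"
      if "hs \<in> nonzero_tuples ?K (dim V - 1)" "l \<in> V - ?K" for hs l
    proof (rule steinberg_bisymbol_eq_0_hyperplane[OF \<phi> V K nK that(2) _ _ ksK])
      show "hs \<in> nonzero_tuples ?K (dim ?K)" using that(1) dK d by metis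
      show "\<phi> (ps @ [n]) qs = 0" if "coxeter_tuples V (ps @ [n]) qs" for ps qs
        using Suc.prems(4)[OF that] by simp
      show "\<psi> us ts = 0"
        if "m \<in> ?K - {0}" "steinberg_bisymbol ?K \<psi>"
          "\<And>ps qs. coxeter_tuples ?K ps qs \<Longrightarrow> last ps = m \<Longrightarrow> \<psi> ps qs = 0"
          "us \<in> nonzero_tuples ?K (dim ?K)" "ts \<in> nonzero_tuples ?K (dim ?K)" for m \<psi> us ts
        using Suc.hyps(1)[OF _ that(2) hyperplane_findim[OF V K] that(1,3,4,5)] dK by metis
    qed
    then show ?thesis
      using steinberg_symbol_eq_0_hyperplane[OF sym V K _ Suc.prems(6)] by blast
  qed
  moreover have "steinberg_symbol V (\<lambda>vs. \<phi> vs ws)"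
    using \<phi> Suc.prems(6) by (simp add: steinberg_bisymbol_def)
  ultimately show ?case
    using steinberg_symbol_eq_0_last[of V "\<lambda>vs. \<phi> vs ws", OF _ n _ Suc.prems(5)] by blast
qed

text \<open>Both factors are reduced to tuples in \<open>H\<close> followed by one vector outside. A
  Coxeter pair whose first tuple is of this kind is covered by \<open>zero\<close>, and inside
  \<open>H\<close> the statement with a prescribed last point applies.\<close>

lemma steinberg_bisymbol_eq_0:
  assumes \<phi>: "steinberg_bisymbol V \<phi>" and V: "findim_subspace V" and H: "hyperplane scale V H"
    and zero: "\<And>ps qs. coxeter_tuples V ps qs \<Longrightarrow> \<forall>i < dim V - 1. ps ! i \<in> H \<Longrightarrow> \<phi> ps qs = 0"
    and vs: "vs \<in> nonzero_tuples V (dim V)" and ws: "ws \<in> nonzero_tuples V (dim V)"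
  shows "\<phi> vs ws = 0"
proof -
  note sub = hyperplane_subspace[OF H]
  have dH: "dim V - 1 = dim H" using sub(3) by simp
  have "\<phi> (hs @ [m]) (gs @ [l]) = 0"
    if hs: "hs \<in> nonzero_tuples H (dim V - 1)" and m: "m \<in> V - H"
      and gs: "gs \<in> nonzero_tuples H (dim V - 1)" and l: "l \<in> V - H" for hs m gs l
  proof (rule steinberg_bisymbol_eq_0_hyperplane[OF \<phi> V H m l])
    show "\<phi> (ps @ [m]) qs = 0"
      if "ps \<in> nonzero_tuples H (dim H)" "coxeter_tuples V (ps @ [m]) qs" for ps qs
      using zero[OF that(2)] nonzero_tuples_nth[OF that(1)] that(1) dH
      by (simp add: nonzero_tuples_def nth_append)
  qed (use steinberg_bisymbol_eq_0_last hyperplane_findim[OF V H] hs gs dH in auto)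
  moreover have "steinberg_symbol V (\<phi> (hs @ [m]))"
    if hs: "hs \<in> nonzero_tuples H (dim V - 1)" and m: "m \<in> V - H" for hs m
  proof -
    have "m \<noteq> 0" using m sub(1) subspace_0 by blast
    then have "hs @ [m] \<in> nonzero_tuples V (dim V)"
      using hs m sub by (auto simp: nonzero_tuples_def)
    then show ?thesis using \<phi> by (simp add: steinberg_bisymbol_def)
  qed
  \<comment> \<open>The second factor is expanded for a fixed \<open>hs @ [m]\<close>; the first
    factor follows for the given \<open>ws\<close>.\<close>
  ultimately have "\<phi> (hs @ [m]) ws = 0"
    if "hs \<in> nonzero_tuples H (dim V - 1)" "m \<in> V - H" for hs m
    using steinberg_symbol_eq_0_hyperplane[OF _ V H _ ws, of "\<phi> (hs @ [m])"] that by blast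
  moreover have "steinberg_symbol V (\<lambda>vs. \<phi> vs ws)"
    using \<phi> ws by (simp add: steinberg_bisymbol_def)
  ultimately show ?thesis
    using steinberg_symbol_eq_0_hyperplane[of V "\<lambda>vs. \<phi> vs ws", OF _ V H _ vs] by blast
qed

text \<open>The scaling relation is applied to one position after another, with the first
  \<open>n\<close> entries already rescaled. The factor depends on the vector and not on the
  position, which fits the choice of one generator per line.\<close>

lemma steinberg_symbol_rescale:
  assumes \<phi>: "steinberg_symbol V \<phi>" and V: "subspace V" and vs: "vs \<in> nonzero_tuples V (dim V)"
    and c: "\<And>v. v \<in> set vs \<Longrightarrow> c v \<noteq> 0"
  shows "\<phi> (map (\<lambda>v. c v *s v) vs) = \<phi> vs"
proof -
  let ?g = "map (\<lambda>v. c v *s v)"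
  have len: "length vs = dim V" using vs by (simp add: nonzero_tuples_def)
  have "\<phi> (?g (take n vs) @ drop n vs) = \<phi> vs" if "n \<le> dim V" for n
    using that
  proof (induction n)
    case (Suc n)
    let ?us = "?g (take n vs) @ drop n vs"
    have n: "n < dim V" using Suc by simp
    have "c v *s v \<in> V - {0}" if "v \<in> set vs" for v
      using that c vs V by (auto simp: nonzero_tuples_def subspace_scale)
    then have tup: "?us \<in> nonzero_tuples V (dim V)"
      using vs len n set_take_subset[of n vs] set_drop_subset[of n vs]
      by (auto simp: nonzero_tuples_def)
    have "?us ! n = vs ! n" using n len by (simp add: nth_append)
    moreover have "?us[n := c (vs ! n) *s vs ! n] = ?g (take (Suc n) vs) @ drop (Suc n) vs"
      using n len by (simp add: list_update_append take_Suc_conv_app_nth Cons_nth_drop_Suc[symmetric])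
    ultimately show ?case
      using steinberg_symbol_scale[OF \<phi> tup n, of "c (vs ! n)"] Suc c n len by simp
  qed simp
  from this[of "dim V"] show ?thesis using len by simp
qed

end


section \<open>The Steinberg module and its tensor square\<close>

context ambient_space
begin

section \<open>From functionals on the Steinberg module to symbols\<close>

lemma steinberg_relations_closed:
  assumes V: "subspace V"
  shows "steinberg_relations scale V \<subseteq> carrier (free_apartments scale V)"
proof -
  let ?F = "free_rat (nonzero_tuples V (dim V))"
  have swap: "vs[i := vs ! j, j := vs ! i] \<in> nonzero_tuples V (dim V)"
    if "vs \<in> nonzero_tuples V (dim V)" "i < dim V" "j < dim V" for vs i j
    using that by (intro nonzero_tuples_update nonzero_tuples_nth)
  have rescale: "vs[i := c *s vs ! i] \<in> nonzero_tuples V (dim V)"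
    if "vs \<in> nonzero_tuples V (dim V)" "i < dim V" "c \<noteq> 0" for vs i c
    using that nonzero_tuples_nth[OF that(1,2)] V
    by (intro nonzero_tuples_update) (auto simp: subspace_scale)
  have omit: "take i vs @ drop (Suc i) vs \<in> nonzero_tuples V (dim V)"
    if "vs \<in> nonzero_tuples V (Suc (dim V))" "i \<le> dim V" for vs i
    using nonzero_tuples_omit[OF that(1), of i] that(2) by simp
  show ?thesis
    unfolding steinberg_relations_def Let_def free_apartments_def
    by (intro Un_least)
      (auto intro!: free_rat_add_closed free_rat_diff_closed free_rat_sum_closed free_gen_closed
        intro: swap rescale omit)
qed

lemma free_apartments_module: "Module.module rat_ring (free_apartments scale V)"
  unfolding free_apartments_def by (rule free_rat_module)

lemma steinberg_kernel_submodule: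
  "subspace V \<Longrightarrow> submodule (steinberg_kernel scale V) rat_ring (free_apartments scale V)"
  unfolding steinberg_kernel_def
  by (rule submodule_span_submodule[OF free_apartments_module steinberg_relations_closed])

lemma steinberg_module: "subspace V \<Longrightarrow> Module.module rat_ring (steinberg scale V)"
  unfolding steinberg_def
  by (rule quotient_module_module[OF free_apartments_module steinberg_kernel_submodule])

lemma apartment_closed:
  "subspace V \<Longrightarrow> vs \<in> nonzero_tuples V (dim V) \<Longrightarrow> apartment scale V vs \<in> carrier (steinberg scale V)"
  unfolding steinberg_def apartment_def
    quotient_module_carrier[OF free_apartments_module steinberg_kernel_submodule]
  by (rule imageI) (simp add: free_apartments_def free_gen_closed)

text \<open>The functional pulls back to the free module on tuples and kills the relations there;
  each of the four families of relations gives one clause.\<close>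

lemma steinberg_symbol_apartment:
  assumes V: "subspace V" and \<gamma>: "rat_linear (steinberg scale V) \<gamma>"
  shows "steinberg_symbol V (\<lambda>vs. \<gamma> (apartment scale V vs))"
proof -
  let ?A = "nonzero_tuples V (dim V)"
  define \<delta> where "\<delta> f = \<gamma> (steinberg_kernel scale V +>\<^bsub>free_apartments scale V\<^esub> f)" for f
  note lin = rat_linear_quotient[OF free_apartments_module steinberg_kernel_submodule[OF V]
      \<gamma>[unfolded steinberg_def]]
  have \<delta>: "rat_linear (free_rat ?A) \<delta>"
    using lin(1) unfolding \<delta>_def free_apartments_def .
  have rel: "\<delta> r = 0" if "r \<in> steinberg_relations scale V" for r
    using lin(2) hull_inc[OF that] by (simp add: \<delta>_def steinberg_kernel_def submodule_span_def)
  have ap: "\<gamma> (apartment scale V vs) = \<delta> (free_gen vs)" for vs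
    by (simp add: \<delta>_def apartment_def)
  note gen = free_gen_closed[of _ ?A]
  have "\<delta> (free_gen vs) = 0" if "vs \<in> ?A" "\<not> distinct vs \<or> dependent (set vs)" for vs
    using that by (intro rel) (auto simp: steinberg_relations_def Let_def)
  moreover have "\<delta> (free_gen (vs[i := vs ! j, j := vs ! i])) = - \<delta> (free_gen vs)"
    if "vs \<in> ?A" "i < dim V" "j < dim V" "i \<noteq> j" for vs i j
  proof -
    have "(\<lambda>us. free_gen (vs[i := vs ! j, j := vs ! i]) us + free_gen vs us)
        \<in> steinberg_relations scale V"
      using that unfolding steinberg_relations_def Let_def by blast
    moreover have "vs[i := vs ! j, j := vs ! i] \<in> ?A"
      using that by (intro nonzero_tuples_update nonzero_tuples_nth)
    ultimately show ?thesis
      using rel that by (fastforce simp: rat_linear_free_add[OF \<delta>] gen eq_neg_iff_add_eq_0)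
  qed
  moreover have "\<delta> (free_gen (vs[i := c *s vs ! i])) = \<delta> (free_gen vs)"
    if "vs \<in> ?A" "i < dim V" "c \<noteq> 0" for vs i c
  proof -
    have "(\<lambda>us. free_gen (vs[i := c *s vs ! i]) us - free_gen vs us) \<in> steinberg_relations scale V"
      using that unfolding steinberg_relations_def Let_def by blast
    moreover have "vs[i := c *s vs ! i] \<in> ?A"
      using that nonzero_tuples_nth[OF that(1,2)] V
      by (intro nonzero_tuples_update) (auto simp: subspace_scale)
    ultimately show ?thesis
      using rel that by (fastforce simp: rat_linear_free_diff[OF \<delta>] gen)
  qed
  moreover have "(\<Sum>i\<le>dim V. (- 1) ^ i * \<delta> (free_gen (take i vs @ drop (Suc i) vs))) = 0"
    if vs: "vs \<in> nonzero_tuples V (Suc (dim V))" for vs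
  proof -
    have "(\<lambda>us. \<Sum>i\<le>dim V. (- 1) ^ i * free_gen (take i vs @ drop (Suc i) vs) us)
        \<in> steinberg_relations scale V"
      using vs unfolding steinberg_relations_def Let_def by blast
    then have "\<delta> (\<lambda>us. \<Sum>i\<le>dim V. (- 1) ^ i * free_gen (take i vs @ drop (Suc i) vs) us) = 0"
      by (rule rel)
    moreover have "free_gen (take i vs @ drop (Suc i) vs) \<in> carrier (free_rat ?A)"
      if "i \<in> {..dim V}" for i
      using nonzero_tuples_omit[OF vs, of i] that gen by simp
    ultimately show ?thesis by (subst (asm) rat_linear_free_sum[OF \<delta>]) auto
  qed
  ultimately show ?thesis unfolding steinberg_symbol_def ap by blast
qed

text \<open>Apartments generate: an element is the class of a finite combination of tuples, and the
  pulled back functional vanishes on each tuple.\<close>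

lemma rat_linear_steinberg_eq_0:
  assumes V: "subspace V" and \<gamma>: "rat_linear (steinberg scale V) \<gamma>"
    and zero: "\<And>vs. vs \<in> nonzero_tuples V (dim V) \<Longrightarrow> \<gamma> (apartment scale V vs) = 0"
    and x: "x \<in> carrier (steinberg scale V)"
  shows "\<gamma> x = 0"
proof -
  obtain f where f: "f \<in> carrier (free_apartments scale V)"
    "x = steinberg_kernel scale V +>\<^bsub>free_apartments scale V\<^esub> f"
    using x quotient_module_carrier[OF free_apartments_module steinberg_kernel_submodule[OF V]]
    by (auto simp: steinberg_def)
  show ?thesis
    using rat_linear_free_eq_0[OF rat_linear_quotient(1)[OF free_apartments_module
          steinberg_kernel_submodule[OF V] \<gamma>[unfolded steinberg_def], unfolded free_apartments_def]]
      zero f by (simp add: apartment_def free_apartments_def)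
qed

section \<open>Lines, simplexes and their generators\<close>

lemma line_generator:
  assumes "v \<noteq> 0"
  obtains c where "c \<noteq> 0" "(SOME u. span {v} = span {u}) = c *s v"
proof -
  define u where "u = (SOME u. span {v} = span {u})"
  have "span {v} = span {u}" unfolding u_def by (rule someI[of _ v]) simp
  then have "u \<in> span {v}" "v \<in> span {u}" by (metis insertI1 span_base)+
  then obtain c k where c: "u = c *s v" and "v = k *s u"
    unfolding span_singleton by blast
  then have "c \<noteq> 0" using assms by auto
  then show ?thesis using that[of c] c by (simp add: u_def)
qed

text \<open>The generators in \<open>simplex_class\<close> are picked by choice, so they agree with
  the given \<open>ps\<close> only up to nonzero factors \<open>c v\<close>;
  \<open>steinberg_symbol_rescale\<close> absorbs these later.\<close>

lemma simplex_class_map_span: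
  assumes "set ps \<subseteq> V - {0}"
  obtains c where "\<And>v. v \<in> set ps \<Longrightarrow> c v \<noteq> 0"
    "simplex_class scale V (map (\<lambda>v. span {v}) ps) = apartment scale V (map (\<lambda>v. c v *s v) ps)"
proof -
  have "\<forall>v\<in>set ps. \<exists>c. c \<noteq> 0 \<and> (SOME u. span {v} = span {u}) = c *s v"
    using assms line_generator by (metis Diff_iff insertI1 subsetD)
  then obtain c where "\<forall>v\<in>set ps. c v \<noteq> 0 \<and> (SOME u. span {v} = span {u}) = c v *s v"
    by metis
  then show ?thesis using that[of c] by (simp add: simplex_class_def cong: map_cong)
qed

lemma simplex_class_closed:
  assumes V: "subspace V" and Ps: "projective_simplex scale V Ps"
  shows "simplex_class scale V Ps \<in> carrier (steinberg scale V)"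
proof -
  have "(SOME v. P = span {v}) \<in> V - {0}" if "P \<in> set Ps" for P
  proof -
    obtain v where v: "v \<in> V - {0}" "P = span {v}"
      using Ps \<open>P \<in> set Ps\<close> by (auto simp: projective_simplex_def projective_points_def)
    obtain c where "c \<noteq> 0" "(SOME u. P = span {u}) = c *s v" using line_generator v by auto
    then show ?thesis using v V by (auto simp: subspace_scale)
  qed
  then have "map (\<lambda>P. SOME v. P = span {v}) Ps \<in> nonzero_tuples V (dim V)"
    using Ps by (auto simp: nonzero_tuples_def projective_simplex_def)
  then show ?thesis unfolding simplex_class_def by (rule apartment_closed[OF V])
qed

text \<open>A line lies in a subspace as soon as its generator does, and a tuple spans the same
  space as its lines, so the conditions on vectors give those on lines.\<close>

lemma coxeter_pair_map_span:
  assumes c: "coxeter_tuples V ps qs" and d: "0 < dim V"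
  shows "coxeter_pair scale V (map (\<lambda>v. span {v}) ps) (map (\<lambda>v. span {v}) qs)"
proof -
  have len: "length ps = dim V" "length qs = dim V"
    and nz: "set ps \<subseteq> V - {0}" "set qs \<subseteq> V - {0}"
    and sp: "span (set ps) = V" "span (set qs) = V"
    using c by (auto simp: coxeter_tuples_def nonzero_tuples_def)
  have "nondegenerate scale V (map (\<lambda>v. span {v}) us)" if "span (set us) = V" for us
  proof -
    have "set us \<subseteq> (\<Union>v\<in>set us. span {v})" by (auto intro: span_base)
    then have "V \<subseteq> span (\<Union>v\<in>set us. span {v})" using that span_mono by blast
    moreover have "(\<Union>v\<in>set us. span {v}) \<subseteq> span (set us)"
      by (intro UN_least span_mono) auto
    then have "span (\<Union>v\<in>set us. span {v}) \<subseteq> V"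
      using that by (metis span_mono span_span)
    ultimately show ?thesis by (simp add: nondegenerate_def)
  qed
  moreover have "projective_simplex scale V (map (\<lambda>v. span {v}) us)"
    if "length us = dim V" "set us \<subseteq> V - {0}" for us
    using that by (auto simp: projective_simplex_def projective_points_def)
  moreover have "map (\<lambda>v. span {v}) qs ! i
      \<subseteq> span (map (\<lambda>v. span {v}) ps ! (i - 1) \<union> map (\<lambda>v. span {v}) ps ! i)"
    if "1 \<le> i" "i < dim V" for i
  proof -
    have "qs ! i \<in> span {ps ! (i - 1), ps ! i}" using c that by (simp add: coxeter_tuples_def)
    moreover have "{ps ! (i - 1), ps ! i} \<subseteq> span {ps ! (i - 1)} \<union> span {ps ! i}"
      by (auto intro: span_base)
    ultimately have "qs ! i \<in> span (span {ps ! (i - 1)} \<union> span {ps ! i})"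
      using span_mono by blast
    then have "span {qs ! i} \<subseteq> span (span {ps ! (i - 1)} \<union> span {ps ! i})"
      by (intro span_minimal) auto
    then show ?thesis using that len by simp
  qed
  moreover have "map (\<lambda>v. span {v}) ps ! 0 = map (\<lambda>v. span {v}) qs ! 0"
    using c d len by (simp add: coxeter_tuples_def)
  ultimately show ?thesis
    unfolding coxeter_pair_def using len nz sp by blast
qed

text \<open>By the duality criterion, a bilinear form vanishing on the given pairs has to be zero.
  Its values on apartments form a bisymbol, to which \<open>steinberg_bisymbol_eq_0\<close> applies.
  Entries are indexed from 0, so \<open>i < dim V - 1\<close> selects all points of
  \<open>Ps\<close> but the last.\<close>

theorem coxeter_tensors_span:
  assumes V: "findim_subspace V" and H: "hyperplane scale V H"
  shows "submodule_span rat_ring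
           (tensor_product (steinberg scale V) (steinberg scale V))
           {coxeter_tensor scale V Ps Qs | Ps Qs.
              coxeter_pair scale V Ps Qs \<and> (\<forall>i < dim V - 1. Ps ! i \<subseteq> H)}
       = carrier (tensor_product (steinberg scale V) (steinberg scale V))"
    (is "submodule_span _ _ ?S = _")
proof (rule tensor_product_span_eqI)
  have sub: "subspace V" using V by (simp add: findim_subspace_def)
  note subH = hyperplane_subspace[OF H]
  show St: "Module.module rat_ring (steinberg scale V)" "Module.module rat_ring (steinberg scale V)"
    by (rule steinberg_module[OF sub])+
  show "?S \<subseteq> carrier (tensor_product (steinberg scale V) (steinberg scale V))"
    by (auto simp: coxeter_tensor_def coxeter_pair_def
        intro!: pure_tensor_closed[OF St] simplex_class_closed[OF sub])
  fix \<beta> x y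
  assume \<beta>: "rat_bilinear (steinberg scale V) (steinberg scale V) \<beta>"
    and zero: "\<And>x y. x \<in> carrier (steinberg scale V) \<Longrightarrow> y \<in> carrier (steinberg scale V)
      \<Longrightarrow> pure_tensor (steinberg scale V) (steinberg scale V) x y \<in> ?S \<Longrightarrow> \<beta> x y = 0"
    and x: "x \<in> carrier (steinberg scale V)" and y: "y \<in> carrier (steinberg scale V)"
  let ?T = "nonzero_tuples V (dim V)"
  define \<phi> where "\<phi> vs ws = \<beta> (apartment scale V vs) (apartment scale V ws)" for vs ws
  have lin1: "rat_linear (steinberg scale V) (\<lambda>x. \<beta> x y)" if "y \<in> carrier (steinberg scale V)" for y
    using \<beta> that by (simp add: rat_bilinear_def)
  have lin2: "rat_linear (steinberg scale V) (\<beta> x)" if "x \<in> carrier (steinberg scale V)" for x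
    using \<beta> that by (simp add: rat_bilinear_def)
  note ap = apartment_closed[OF sub]
  have sym1: "steinberg_symbol V (\<lambda>vs. \<phi> vs ws)" if "ws \<in> ?T" for ws
    unfolding \<phi>_def using steinberg_symbol_apartment[OF sub lin1[OF ap[OF that]]] .
  have sym2: "steinberg_symbol V (\<phi> vs)" if "vs \<in> ?T" for vs
    unfolding \<phi>_def using steinberg_symbol_apartment[OF sub lin2[OF ap[OF that]]] .
  have bi: "steinberg_bisymbol V \<phi>" using sym1 sym2 by (simp add: steinberg_bisymbol_def)
  have "\<phi> ps qs = 0" if c: "coxeter_tuples V ps qs" and pH: "\<forall>i < dim V - 1. ps ! i \<in> H" for ps qs
  proof -
    have pq: "ps \<in> ?T" "qs \<in> ?T" using c by (auto simp: coxeter_tuples_def)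
    then have nz: "set ps \<subseteq> V - {0}" "set qs \<subseteq> V - {0}" and len: "length ps = dim V"
      by (auto simp: nonzero_tuples_def)
    let ?Ps = "map (\<lambda>v. span {v}) ps" and ?Qs = "map (\<lambda>v. span {v}) qs"
    obtain a where a: "\<And>v. v \<in> set ps \<Longrightarrow> a v \<noteq> 0"
      "simplex_class scale V ?Ps = apartment scale V (map (\<lambda>v. a v *s v) ps)"
      using simplex_class_map_span[OF nz(1)] by blast
    obtain b where b: "\<And>v. v \<in> set qs \<Longrightarrow> b v \<noteq> 0"
      "simplex_class scale V ?Qs = apartment scale V (map (\<lambda>v. b v *s v) qs)"
      using simplex_class_map_span[OF nz(2)] by blast
    have cox: "coxeter_pair scale V ?Ps ?Qs" using coxeter_pair_map_span[OF c] subH(3) by simp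
    moreover have "?Ps ! i \<subseteq> H" if "i < dim V - 1" for i
      using pH that len subH(1) by (simp add: span_minimal)
    ultimately have "coxeter_tensor scale V ?Ps ?Qs \<in> ?S" by blast
    then have "\<beta> (simplex_class scale V ?Ps) (simplex_class scale V ?Qs) = 0"
      using zero simplex_class_closed[OF sub] cox by (simp add: coxeter_tensor_def coxeter_pair_def)
    then have "\<phi> (map (\<lambda>v. a v *s v) ps) (map (\<lambda>v. b v *s v) qs) = 0"
      by (simp add: \<phi>_def a(2) b(2))
    moreover have "map (\<lambda>v. b v *s v) qs \<in> ?T"
      using pq(2) nz(2) b(1) sub by (auto simp: nonzero_tuples_def subspace_scale)
    \<comment> \<open>The chosen generators are traded for the entries of \<open>ps\<close> and
      \<open>qs\<close>, one factor at a time.\<close>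
    ultimately show ?thesis
      using steinberg_symbol_rescale[OF sym1 sub pq(1) a(1)]
        steinberg_symbol_rescale[OF sym2[OF pq(1)] sub pq(2) b(1)] by simp
  qed
  then have "\<phi> vs ws = 0" if "vs \<in> ?T" "ws \<in> ?T" for vs ws
    using steinberg_bisymbol_eq_0[OF bi V H _ that] by blast
  \<comment> \<open>From apartments to arbitrary elements, first in the left variable and then in
    the right one.\<close>
  then have "\<beta> x (apartment scale V ws) = 0" if "ws \<in> ?T" for ws
    using rat_linear_steinberg_eq_0[OF sub lin1[OF ap[OF that]] _ x] that by (simp add: \<phi>_def)
  then show "\<beta> x y = 0"
    using rat_linear_steinberg_eq_0[OF sub lin2[OF x] _ y] by blast
qed

end

theorem theorem23:
  fixes scale :: "'f::field \<Rightarrow> 'v::ab_group_add \<Rightarrow> 'v"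
    and V H :: "'v set"
    and d :: nat
  assumes "vector_space scale"
    and "module.subspace scale V"
    and "\<exists>B. finite B \<and> V = module.span scale B"
    and "vector_space.dim scale V = d"
    and "hyperplane scale V H"
  shows "submodule_span rat_ring
           (tensor_product (steinberg scale V) (steinberg scale V))
           {coxeter_tensor scale V Ps Qs | Ps Qs.
              coxeter_pair scale V Ps Qs \<and> (\<forall>i < d - 1. Ps ! i \<subseteq> H)}
       = carrier (tensor_product (steinberg scale V) (steinberg scale V))"
proof -
  interpret ambient_space scale using assms(1) by (rule ambient_space.intro)
  have "findim_subspace V" using assms(2,3) by (simp add: findim_subspace_def)
  from coxeter_tensors_span[OF this assms(5)] show ?thesis using assms(4) by simp
qed

end
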